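(* Let $\mathcal{H}$ and $\mathcal{G}$ be real Hilbert spaces, let $f:\mathcal{H}\to\mathbb{R}\cup\{+\infty\}$ and $g:\mathcal{G}\to\mathbb{R}\cup\{+\infty\}$ be convex, proper, and lower semicontinuous, and let $L:\mathcal{H}\to\mathcal{G}$ be a bounded linear operator. Suppose that there exists at least one KKT point, i.e. a point $(x^\star,y^\star)\in\mathcal{H}\times\mathcal{G}$ with $-L^*y^\star\in\partial f(x^\star)$ and $Lx^\star\in\partial g^*(y^\star)$. Let $\tau,\sigma,\theta\in\mathbb{R}$ satisfy $$\tau,\sigma>0,\qquad 0<\theta\le \tfrac12,\qquad \tau\sigma\|L\|^2<\frac{4\theta(2-\theta)}{1-2\theta+9\theta^2-4\theta^3}.$$ Let $(x^0,y^0)\in\mathcal{H}\times\mathcal{G}$ be arbitrary and let $((x^k,y^k))_{k\ge 0}$ be generated by the Chambolle--Pock iteration: for every integer $k\ge 0$, $$x^{k+1}=\operatorname{prox}_{\tau f}\left(x^k-\tau L^*y^k\right),\qquad y^{k+1}=\operatorname{prox}_{\sigma g^*}\left(y^k+\sigma L\left(x^{k+1}+\theta(x^{k+1}-x^k)\right)\right).$$ Then there exists a KKT point $(x^\star,y^\star)\in\mathcal{H}\times\mathcal{G}$ such that $(x^k,y^k)\rightharpoonup(x^\star,y^\star)$ as $k\to\infty$.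
   Context: $\rightharpoonup$ denotes weak convergence in the Hilbert space $\mathcal{H}\times\mathcal{G}$ with the canonical inner product $\langle (x,y),(\bar x,\bar y)\rangle=\langle x,\bar x\rangle+\langle y,\bar y\rangle$. $\|L\|$ is the operator norm and $L^*:\mathcal{G}\to\mathcal{H}$ the adjoint of $L$. A function is proper if it is not identically $+\infty$ (it takes values in $\mathbb{R}\cup\{+\infty\}$). The convex subdifferential is $\partial f(x)=\{u : f(y)\ge f(x)+\langle u,y-x\rangle \text{ for all } y\}$. The convex conjugate is $g^*(u)=\sup_{y\in\mathcal{G}}(\langle u,y\rangle-g(y))$. For $\gamma>0$ and a proper, convex, lower semicontinuous function $h$, $\operatorname{prox}_{\gamma h}(x)=\operatorname{argmin}_{z}\left(h(z)+\frac{1}{2\gamma}\|x-z\|^2\right)$ (a single-valued, everywhere defined map). *)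

theory Defs
  imports "HOL-Analysis.Analysis"
begin

text \<open>Functions with values in the reals extended by $+\infty$ are modelled as
  \<^typ>\<open>ereal\<close>-valued functions; the value $-\infty$ is excluded by properness.\<close>

definition proper_fun :: "('a \<Rightarrow> ereal) \<Rightarrow> bool" where
  "proper_fun f \<longleftrightarrow> (\<forall>x. f x \<noteq> -\<infinity>) \<and> (\<exists>x. f x \<noteq> \<infinity>)"

text \<open>On \<^typ>\<open>ereal\<close> one has $0\cdot\infty = 0$, so the cases $u = 0$ and $v = 0$ are harmless.\<close>

definition convex_fun :: "('a::real_vector \<Rightarrow> ereal) \<Rightarrow> bool" where
  "convex_fun f \<longleftrightarrow> (\<forall>x y. \<forall>u\<ge>0. \<forall>v\<ge>0. u + v = 1 \<longrightarrow>
     f (u *\<^sub>R x + v *\<^sub>R y) \<le> ereal u * f x + ereal v * f y)"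

definition lsc_fun :: "('a::topological_space \<Rightarrow> ereal) \<Rightarrow> bool" where
  "lsc_fun f \<longleftrightarrow> (\<forall>x. f x \<le> Liminf (at x) f)"

definition subdifferential :: "('a::real_inner \<Rightarrow> ereal) \<Rightarrow> 'a \<Rightarrow> 'a set" where
  "subdifferential f x = {u. \<forall>y. f y \<ge> f x + ereal (u \<bullet> (y - x))}"

definition convex_conjugate :: "('a::real_inner \<Rightarrow> ereal) \<Rightarrow> 'a \<Rightarrow> ereal" where
  "convex_conjugate g u = (SUP y. ereal (u \<bullet> y) - g y)"

text \<open>\<^term>\<open>prox \<gamma> h\<close> is the proximal map of the scaled function $\gamma h$. For proper, convex,
  lower semicontinuous \<^term>\<open>h\<close> on a Hilbert space and $\gamma > 0$ the minimizer exists and is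
  unique, so the choice made by \<^const>\<open>arg_min\<close> is forced.\<close>

definition prox :: "real \<Rightarrow> ('a::real_inner \<Rightarrow> ereal) \<Rightarrow> 'a \<Rightarrow> 'a" where
  "prox \<gamma> h x = (ARG_MIN (\<lambda>z. h z + ereal (1 / (2 * \<gamma>) * (norm (x - z))\<^sup>2)) z. True)"

definition kkt_point ::
  "('a::real_inner \<Rightarrow> ereal) \<Rightarrow> ('b::real_inner \<Rightarrow> ereal) \<Rightarrow> ('a \<Rightarrow> 'b) \<Rightarrow> 'a \<times> 'b \<Rightarrow> bool" where
  "kkt_point f g L = (\<lambda>(x, y).
     - adjoint L y \<in> subdifferential f x \<and> L x \<in> subdifferential (convex_conjugate g) y)"

definition weakly_converges :: "(nat \<Rightarrow> 'a::real_inner) \<Rightarrow> 'a \<Rightarrow> bool" where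
  "weakly_converges z l \<longleftrightarrow> (\<forall>w. (\<lambda>n. z n \<bullet> w) \<longlonglongrightarrow> l \<bullet> w)"

end

theory Submission
  imports Defs
begin

text \<open>Write \<open>m(u, v) = \<parallel>u\<parallel>\<^sup>2 / \<tau> + \<parallel>v\<parallel>\<^sup>2 / \<sigma> - (1 + \<theta>) \<langle>L u, v\<rangle>\<close> and let \<open>\<G>\<^sub>k \<ge> 0\<close> be the primal-dual gap
  of the \<open>k\<close>-th iterate \<open>z\<^sub>k\<close> relative to a KKT point \<open>z\<close>. Then
  \<open>E\<^sub>k = m(z\<^sub>k - z) + m(z\<^sub>k - z\<^sub>k\<^sub>-\<^sub>1) / 2 + (1 + \<theta>) \<G>\<^sub>k\<close> decreases in each step by at least
  \<open>2 \<G>\<^sub>k\<close> plus half of a quadratic form in two consecutive differences of iterates. Completing the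
  square shows that the step-size bound is exactly the condition that makes this form positive;
  it also makes \<open>m\<close> positive definite. Hence differences and gaps vanish and \<open>m(z\<^sub>k - z)\<close> converges
  for every KKT point \<open>z\<close>, so Opial's argument with respect to \<open>m\<close> applies as soon as weak cluster
  points are KKT points.\<close>

section \<open>Subgradients, proximal maps and conjugates\<close>

lemma subdifferential_finite:
  assumes "proper_fun f" "u \<in> subdifferential f x"
  shows "\<bar>f x\<bar> \<noteq> \<infinity>"
proof -
  obtain y where y: "f y \<noteq> \<infinity>" and nm: "\<forall>x. f x \<noteq> -\<infinity>"
    using assms(1) by (auto simp: proper_fun_def)
  have "f x + ereal (u \<bullet> (y - x)) \<le> f y"
    using assms(2) by (auto simp: subdifferential_def)
  then have "f x \<noteq> \<infinity>" using y by auto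
  then show ?thesis using nm by auto
qed

lemma subdifferential_real:
  assumes "proper_fun f" "u \<in> subdifferential f x" "\<bar>f y\<bar> \<noteq> \<infinity>"
  shows "real_of_ereal (f x) + u \<bullet> (y - x) \<le> real_of_ereal (f y)"
proof -
  have "f x + ereal (u \<bullet> (y - x)) \<le> f y"
    using assms(2) by (auto simp: subdifferential_def)
  moreover have "\<bar>f x\<bar> \<noteq> \<infinity>" by (rule subdifferential_finite[OF assms(1,2)])
  ultimately show ?thesis using assms(3)
    by (cases "f x"; cases "f y") auto
qed

lemma subdifferential_monotone:
  assumes "proper_fun f" "u \<in> subdifferential f x" "v \<in> subdifferential f y"
  shows "(u - v) \<bullet> (x - y) \<ge> 0"
  using subdifferential_real[OF assms(1,2) subdifferential_finite[OF assms(1,3)]]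
    subdifferential_real[OF assms(1,3) subdifferential_finite[OF assms(1,2)]]
  by (simp add: algebra_simps inner_diff_right inner_diff_left)

lemma convex_fun_real:
  assumes "convex_fun f" "0 \<le> t" "t \<le> 1" "f x \<le> ereal a" "f y \<le> ereal b"
  shows "f ((1 - t) *\<^sub>R x + t *\<^sub>R y) \<le> ereal ((1 - t) * a + t * b)"
proof -
  have "f ((1 - t) *\<^sub>R x + t *\<^sub>R y) \<le> ereal (1 - t) * f x + ereal t * f y"
    using assms(1-3) by (simp add: convex_fun_def)
  also have "\<dots> \<le> ereal (1 - t) * ereal a + ereal t * ereal b"
    using assms by (intro add_mono ereal_mult_left_mono) auto
  finally show ?thesis by simp
qed

section \<open>Lower semicontinuity along neighbourhoods and sequences\<close>

lemma lsc_fun_nhds: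
  assumes "lsc_fun f" "c < f x"
  shows "\<forall>\<^sub>F z in nhds x. c < f z"
proof -
  have "c < Liminf (at x) f" using assms by (auto simp: lsc_fun_def intro: less_le_trans)
  then have "\<forall>\<^sub>F z in at x. c < f z" by (rule less_LiminfD)
  then show ?thesis using assms(2) by (auto simp: eventually_at_filter elim: eventually_mono)
qed

text \<open>The bound varies with \<open>n\<close> because a minimizing sequence is controlled by
  the infimum plus an error minus a quadratic term that moves with the sequence.\<close>

lemma lsc_fun_limit_le:
  assumes "lsc_fun f" "z \<longlonglongrightarrow> l" "b \<longlonglongrightarrow> B" "\<And>n::nat. f (z n) \<le> ereal (b n)"
  shows "f l \<le> ereal B"
proof (rule ccontr)
  assume "\<not> f l \<le> ereal B"
  then obtain c where c: "ereal B < ereal c" "ereal c < f l"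
    using ereal_dense2 by (metis not_le)
  have "\<forall>\<^sub>F n in sequentially. ereal c < f (z n)"
    using lsc_fun_nhds[OF assms(1) c(2)] assms(2) by (auto simp: filterlim_def le_filter_def eventually_filtermap)
  moreover have "\<forall>\<^sub>F n in sequentially. b n < c"
    using order_tendstoD(2)[OF assms(3)] c(1) by auto
  ultimately have "\<forall>\<^sub>F n in sequentially. False"
  proof eventually_elim
    case (elim n)
    have "ereal c < ereal (b n)" using elim(1) assms(4)[of n] by (rule less_le_trans)
    with elim(2) show ?case by simp
  qed
  then show False by simp
qed

text \<open>Near \<open>x\<close> the function exceeds \<open>f x - 1\<close>; convexity propagates this along rays from \<open>x\<close>.\<close>

lemma convex_lsc_lower_bound:
  fixes f :: "'a::real_normed_vector \<Rightarrow> ereal"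
  assumes "convex_fun f" "lsc_fun f" "f x = ereal m"
  obtains K where "K \<ge> 0" "\<And>z. f z \<ge> ereal (m - 1 - K * norm (z - x))"
proof -
  have "\<forall>\<^sub>F z in nhds x. ereal (m - 1) < f z"
    using assms by (intro lsc_fun_nhds) auto
  then obtain e where e: "e > 0" "\<And>z. dist z x < e \<Longrightarrow> ereal (m - 1) < f z"
    by (auto simp: eventually_nhds_metric)
  define r where "r = e / 2"
  have r: "r > 0" "\<And>z. norm (z - x) \<le> r \<Longrightarrow> ereal (m - 1) < f z"
    using e by (auto simp: r_def dist_norm)
  have "f z \<ge> ereal (m - 1 - 1 / r * norm (z - x))" for z
  proof (cases "norm (z - x) \<le> r")
    case True
    have "ereal (m - 1 - 1 / r * norm (z - x)) \<le> ereal (m - 1)" using r(1) by simp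
    also have "\<dots> \<le> f z" using r(2)[OF True] by simp
    finally show ?thesis .
  next
    case False
    \<comment> \<open>This \<open>t\<close> pulls \<open>z\<close> back to the sphere of radius
      \<open>r\<close> about \<open>x\<close>, where the local lower bound still holds.\<close>
    define t where "t = r / norm (z - x)"
    have t: "0 < t" "t \<le> 1" using False r(1) by (auto simp: t_def divide_simps)
    have "norm (t *\<^sub>R (z - x)) = r" using False r(1) by (auto simp: t_def)
    moreover have "t *\<^sub>R (z - x) = (1 - t) *\<^sub>R x + t *\<^sub>R z - x" by (simp add: algebra_simps)
    ultimately have "norm ((1 - t) *\<^sub>R x + t *\<^sub>R z - x) = r" by simp
    then have w: "ereal (m - 1) < f ((1 - t) *\<^sub>R x + t *\<^sub>R z)" using r(2) by simp
    show ?thesis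
    proof (rule ccontr)
      assume "\<not> ?thesis"
      then have le: "f z \<le> ereal (m - 1 - 1 / r * norm (z - x))" by simp
      have "f ((1 - t) *\<^sub>R x + t *\<^sub>R z) \<le> ereal ((1 - t) * m + t * (m - 1 - 1 / r * norm (z - x)))"
        using convex_fun_real[OF assms(1) _ t(2) _ le, of x m] t assms(3) by simp
      then have "ereal (m - 1) < ereal ((1 - t) * m + t * (m - 1 - 1 / r * norm (z - x)))"
        using w by (rule less_le_trans[rotated])
      moreover define D where "D = 1 / r * norm (z - x)"
      have D: "t * D = 1" using False r(1) by (auto simp: t_def D_def)
      have "(1 - t) * m + t * (m - 1 - D) = m - t - t * D" by (simp add: algebra_simps)
      ultimately have "m - 1 < m - t - 1" unfolding D D_def[symmetric] by simp
      then show False using t(1) by simp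
    qed
  qed
  then show ?thesis using that[of "1 / r"] r(1) by auto
qed

section \<open>Existence and optimality condition of the proximal point\<close>

lemma norm_midpoint:
  fixes x z w :: "'a::real_inner"
  shows "(norm (x - ((1 - 1/2) *\<^sub>R z + (1/2) *\<^sub>R w)))\<^sup>2
    = (norm (x - z))\<^sup>2 / 2 + (norm (x - w))\<^sup>2 / 2 - (norm (z - w))\<^sup>2 / 4"
  unfolding power2_norm_eq_inner
  by (simp add: inner_diff_right inner_diff_left inner_add_right inner_add_left inner_commute field_simps)

text \<open>Strong convexity of the quadratic term makes a minimizing sequence Cauchy, so norm
  completeness does the work of weak compactness.\<close>

lemma prox_minimizer_exists:
  fixes f :: "'a::{real_inner,complete_space} \<Rightarrow> ereal"
  assumes "convex_fun f" "proper_fun f" "lsc_fun f" "\<gamma> > 0"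
  shows "\<exists>p. \<forall>z. f p + ereal (1 / (2 * \<gamma>) * (norm (x - p))\<^sup>2)
    \<le> f z + ereal (1 / (2 * \<gamma>) * (norm (x - z))\<^sup>2)"
proof -
  define q where "q = (\<lambda>z. 1 / (2 * \<gamma>) * (norm (x - z))\<^sup>2)"
  define h where "h = (\<lambda>z. f z + ereal (q z))"
  obtain x0 m where m: "f x0 = ereal m"
    using assms(2) unfolding proper_fun_def by (metis real_of_ereal.elims)
  obtain K where K: "K \<ge> 0" "\<And>z. f z \<ge> ereal (m - 1 - K * norm (z - x0))"
    using convex_lsc_lower_bound[OF assms(1,3) m] by metis
  \<comment> \<open>The last term is the minimum of \<open>s^2 / (2 * \<gamma>) - K * s\<close> over
    real \<open>s\<close>, taken with \<open>s = norm (x - z)\<close>; the rest is the triangle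
    inequality.\<close>
  define C where "C = m - 1 - K * norm (x - x0) - K\<^sup>2 * \<gamma> / 2"
  have lower: "ereal C \<le> h z" for z
  proof -
    have "norm (z - x0) \<le> norm (x - z) + norm (x - x0)"
      using norm_triangle_ineq4[of "x - x0" "x - z"] by simp
    then have "K * norm (z - x0) \<le> K * norm (x - z) + K * norm (x - x0)"
      using K(1) by (metis distrib_left mult_left_mono)
    moreover have "0 \<le> 1 / (2 * \<gamma>) * (norm (x - z) - K * \<gamma>)\<^sup>2" using assms(4) by simp
    then have "K * norm (x - z) \<le> q z + K\<^sup>2 * \<gamma> / 2"
      using assms(4) by (simp add: q_def field_simps power2_eq_square)
    ultimately have "ereal C \<le> ereal (m - 1 - K * norm (z - x0)) + ereal (q z)"
      by (simp add: C_def)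
    also have "\<dots> \<le> h z" unfolding h_def using K(2) by (intro add_mono) auto
    finally show ?thesis .
  qed
  define I where "I = Inf (range h)"
  have "I \<le> ereal (m + q x0)" using m by (auto simp: I_def h_def intro!: INF_lower2[of x0])
  moreover have "ereal C \<le> I" using lower by (auto simp: I_def intro: Inf_greatest)
  ultimately obtain i where i: "I = ereal i" by (cases I) auto
  have "\<exists>z. h z < ereal (i + 1 / real (Suc n))" for n
  proof -
    have "I < ereal (i + 1 / real (Suc n))" by (simp add: i)
    then show ?thesis by (auto simp: I_def Inf_less_iff)
  qed
  then obtain z where z: "\<And>n. h (z n) < ereal (i + 1 / real (Suc n))" by metis
  have fz: "f (z n) \<le> ereal (i + 1 / real (Suc n) - q (z n))" for n
    using z[of n] by (cases "f (z n)") (auto simp: h_def)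
  \<comment> \<open>At the midpoint the quadratic term lies below the average of the two values by
    \<open>norm (z n - z k)^2 / (8 * \<gamma>)\<close>. The value there is still at least
    \<open>i\<close>, so this amount is at most the mean of the two errors.\<close>
  have dist_le: "(norm (z n - z k))\<^sup>2 \<le> 4 * \<gamma> * (1 / real (Suc n) + 1 / real (Suc k))" for n k
  proof -
    let ?w = "(1 - 1/2) *\<^sub>R z n + (1/2) *\<^sub>R z k"
    have "f ?w \<le> ereal ((1 - 1/2) * (i + 1 / real (Suc n) - q (z n)) + 1/2 * (i + 1 / real (Suc k) - q (z k)))"
      using convex_fun_real[OF assms(1) _ _ fz fz, of "1/2"] by simp
    moreover have "ereal i \<le> h ?w" unfolding i[symmetric] I_def by (rule Inf_lower) auto
    ultimately obtain r where r: "f ?w = ereal r"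
        "r \<le> (1 - 1/2) * (i + 1 / real (Suc n) - q (z n)) + 1/2 * (i + 1 / real (Suc k) - q (z k))"
        "i \<le> r + q ?w"
      unfolding h_def by (cases "f ?w") auto
    moreover have "q ?w = q (z n) / 2 + q (z k) / 2 - (norm (z n - z k))\<^sup>2 / (8 * \<gamma>)"
      unfolding q_def norm_midpoint using assms(4) by (simp add: field_simps)
    moreover define a b where "a = 1 / real (Suc n)" and "b = 1 / real (Suc k)"
    ultimately have "(norm (z n - z k))\<^sup>2 / (8 * \<gamma>) \<le> (a + b) / 2"
      unfolding a_def[symmetric] b_def[symmetric] by argo
    then show ?thesis unfolding a_def[symmetric] b_def[symmetric]
      using assms(4) by (simp add: pos_divide_le_eq algebra_simps)
  qed
  have "Cauchy z"
  proof (rule metric_CauchyI)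
    fix e :: real assume e: "e > 0"
    have "(\<lambda>n. 8 * \<gamma> * (1 / real (Suc n))) \<longlonglongrightarrow> 8 * \<gamma> * 0"
      by (intro tendsto_mult tendsto_const LIMSEQ_Suc[OF lim_1_over_n])
    then have "\<forall>\<^sub>F n in sequentially. 8 * \<gamma> * (1 / real (Suc n)) < e\<^sup>2"
      by (rule order_tendstoD) (use e in simp)
    then obtain N where N: "8 * \<gamma> * (1 / real (Suc N)) < e\<^sup>2" by (auto simp: eventually_sequentially)
    have "dist (z n) (z k) < e" if "n \<ge> N" "k \<ge> N" for n k
    proof -
      have "1 / real (Suc n) \<le> 1 / real (Suc N)" "1 / real (Suc k) \<le> 1 / real (Suc N)"
        using that by (auto simp: frac_le)
      then have "4 * \<gamma> * (1 / real (Suc n) + 1 / real (Suc k)) \<le> 4 * \<gamma> * (1 / real (Suc N) + 1 / real (Suc N))"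
        using assms(4) by (intro mult_left_mono) auto
      moreover have "4 * \<gamma> * (c + c) = 8 * \<gamma> * c" for c by simp
      ultimately have "(norm (z n - z k))\<^sup>2 < e\<^sup>2" using dist_le[of n k] N by (metis le_less_trans order_trans)
      then show ?thesis using e by (simp add: dist_norm power2_less_imp_less)
    qed
    then show "\<exists>M. \<forall>m\<ge>M. \<forall>n\<ge>M. dist (z m) (z n) < e" by blast
  qed
  then obtain p where p: "z \<longlonglongrightarrow> p" using Cauchy_convergent convergent_def by blast
  have "(\<lambda>n. i + 1 / real (Suc n) - q (z n)) \<longlonglongrightarrow> i + 0 - q p"
    unfolding q_def by (intro tendsto_intros p LIMSEQ_Suc[OF lim_1_over_n])
  then have "f p \<le> ereal (i - q p)" using lsc_fun_limit_le[OF assms(3) p _ fz] by simp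
  then have "h p \<le> I" unfolding h_def i by (cases "f p") auto
  then have "\<forall>z. h p \<le> h z" unfolding I_def by (meson Inf_lower order_trans rangeI)
  then show ?thesis unfolding h_def q_def by blast
qed

text \<open>First-order optimality: the minimizer is compared with the points of the segment towards
  \<open>y\<close>. After division by \<open>t\<close>, only the linear part of the square survives
  as \<open>t\<close> tends to 0.\<close>

lemma prox_subgradient:
  fixes f :: "'a::{real_inner,complete_space} \<Rightarrow> ereal"
  assumes "convex_fun f" "proper_fun f" "lsc_fun f" "\<gamma> > 0"
  shows "(1 / \<gamma>) *\<^sub>R (x - prox \<gamma> f x) \<in> subdifferential f (prox \<gamma> f x)"
proof -
  define h where "h = (\<lambda>z. f z + ereal (1 / (2 * \<gamma>) * (norm (x - z))\<^sup>2))"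
  define p where "p = prox \<gamma> f x"
  \<comment> \<open>\<open>prox\<close> is a choice, so it is a minimizer only once some minimizer
    is known to exist.\<close>
  have "\<exists>p. is_arg_min h (\<lambda>_. True) p"
    using prox_minimizer_exists[OF assms, of x] by (auto simp: is_arg_min_def h_def not_less)
  then have "is_arg_min h (\<lambda>_. True) p"
    unfolding p_def prox_def arg_min_def h_def by (rule someI_ex)
  then have min: "h p \<le> h z" for z by (auto simp: is_arg_min_def not_less)
  have nm: "f z \<noteq> -\<infinity>" for z using assms(2) by (simp add: proper_fun_def)
  obtain x0 where x0: "f x0 \<noteq> \<infinity>" using assms(2) by (auto simp: proper_fun_def)
  have "f p \<noteq> \<infinity>" using min[of x0] x0 by (auto simp: h_def)
  then obtain fp where fp: "f p = ereal fp" using nm[of p] by (cases "f p") auto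
  have "f y \<ge> f p + ereal (((1 / \<gamma>) *\<^sub>R (x - p)) \<bullet> (y - p))" for y
  proof (cases "f y")
    case (real fy)
    define c where "c = 1 / (2 * \<gamma>)"
    have c: "2 * c = 1 / \<gamma>" by (simp add: c_def)
    have *: "fp + (x - p) \<bullet> (y - p) / \<gamma> \<le> fy + t * ((norm (y - p))\<^sup>2 / (2 * \<gamma>))" if t: "0 < t" "t \<le> 1" for t
    proof -
      let ?w = "(1 - t) *\<^sub>R p + t *\<^sub>R y"
      have "f ?w \<le> ereal ((1 - t) * fp + t * fy)"
        using convex_fun_real[OF assms(1), of t p fp y fy] t fp real by simp
      then have "fp + c * (norm (x - p))\<^sup>2 \<le> (1 - t) * fp + t * fy + c * (norm (x - ?w))\<^sup>2"
        using min[of ?w] nm[of ?w] unfolding h_def c_def[symmetric] by (cases "f ?w") (auto simp: fp)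
      moreover have "(norm (x - ?w))\<^sup>2 = (norm (x - p))\<^sup>2 - 2 * t * ((x - p) \<bullet> (y - p)) + t\<^sup>2 * (norm (y - p))\<^sup>2"
        unfolding power2_norm_eq_inner
        by (simp add: inner_diff_right inner_diff_left inner_add_right inner_add_left inner_commute)
          (simp add: algebra_simps power2_eq_square)
      ultimately have "t * (fp + 2 * c * ((x - p) \<bullet> (y - p))) \<le> t * (fy + t * (c * (norm (y - p))\<^sup>2))"
        by (simp only:) (simp add: algebra_simps power2_eq_square[of t])
      then show ?thesis using t(1) by (simp add: c) (simp add: c_def)
    qed
    have "((\<lambda>t. fy + t * ((norm (y - p))\<^sup>2 / (2 * \<gamma>))) \<longlongrightarrow> fy + 0 * ((norm (y - p))\<^sup>2 / (2 * \<gamma>))) (at_right 0)"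
      by (intro tendsto_intros)
    moreover have "\<forall>\<^sub>F t in at_right 0. fp + (x - p) \<bullet> (y - p) / \<gamma> \<le> fy + t * ((norm (y - p))\<^sup>2 / (2 * \<gamma>))"
      by (rule eventually_mono[OF eventually_at_right_real[of 0 "1::real"]]) (simp only: zero_less_one, rule *, auto)
    ultimately have "fp + (x - p) \<bullet> (y - p) / \<gamma> \<le> fy + 0 * ((norm (y - p))\<^sup>2 / (2 * \<gamma>))"
      by (rule tendsto_lowerbound) simp
    then show ?thesis by (simp add: real fp)
  qed (use nm in auto)
  then show ?thesis unfolding p_def[symmetric] by (simp add: subdifferential_def)
qed

section \<open>Convexity, lower semicontinuity and properness of the conjugate\<close>

lemma convex_conjugate_convex_fun:
  assumes "proper_fun g"
  shows "convex_fun (convex_conjugate g)"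
  unfolding convex_fun_def
proof (intro allI impI)
  fix x y :: 'a and u v :: real
  assume uv: "u \<ge> 0" "v \<ge> 0" "u + v = 1"
  show "convex_conjugate g (u *\<^sub>R x + v *\<^sub>R y) \<le> ereal u * convex_conjugate g x + ereal v * convex_conjugate g y"
    unfolding convex_conjugate_def[of g "u *\<^sub>R x + v *\<^sub>R y"]
  proof (rule SUP_least)
    fix z
    show "ereal ((u *\<^sub>R x + v *\<^sub>R y) \<bullet> z) - g z \<le> ereal u * convex_conjugate g x + ereal v * convex_conjugate g y"
    proof (cases "g z")
      case (real r)
      have "ereal ((u *\<^sub>R x + v *\<^sub>R y) \<bullet> z) - g z = ereal u * (ereal (x \<bullet> z) - g z) + ereal v * (ereal (y \<bullet> z) - g z)"
      proof -
        have "r = u * r + v * r" using uv(3) by (metis distrib_right mult_1)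
        then show ?thesis by (simp add: real inner_add_left algebra_simps)
      qed
      also have "\<dots> \<le> ereal u * convex_conjugate g x + ereal v * convex_conjugate g y"
        using uv by (intro add_mono ereal_mult_left_mono) (auto simp: convex_conjugate_def intro: SUP_upper)
      finally show ?thesis .
    qed (use assms in \<open>auto simp: proper_fun_def\<close>)
  qed
qed

text \<open>A supremum of continuous affine functions is lower semicontinuous; each \<open>y\<close>
  with finite \<open>g y\<close> contributes one of them.\<close>

lemma convex_conjugate_lsc_fun:
  assumes "proper_fun g"
  shows "lsc_fun (convex_conjugate g)"
  unfolding lsc_fun_def
proof
  fix u
  have "ereal (u \<bullet> y) - g y \<le> Liminf (at u) (convex_conjugate g)" for y
  \<comment> \<open>The punctured filter is trivial only in the zero space, where the lower limit is
    the top element.\<close>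
  proof (cases "at u = bot")
    case False
    show ?thesis
    proof (cases "g y")
      case (real r)
      have "((\<lambda>w. ereal (w \<bullet> y) - g y) \<longlongrightarrow> ereal (u \<bullet> y) - g y) (at u)"
        by (simp add: real) (intro tendsto_intros)
      then have "Liminf (at u) (\<lambda>w. ereal (w \<bullet> y) - g y) = ereal (u \<bullet> y) - g y"
        using False by (intro lim_imp_Liminf)
      moreover have "Liminf (at u) (\<lambda>w. ereal (w \<bullet> y) - g y) \<le> Liminf (at u) (convex_conjugate g)"
        by (intro Liminf_mono always_eventually) (auto simp: convex_conjugate_def intro: SUP_upper)
      ultimately show ?thesis by simp
    qed (use assms in \<open>auto simp: proper_fun_def\<close>)
  qed (simp add: top_ereal_def)
  then show "convex_conjugate g u \<le> Liminf (at u) (convex_conjugate g)"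
    unfolding convex_conjugate_def[of g u] by (intro SUP_least) auto
qed

text \<open>A point where \<open>g\<close> is finite bounds the conjugate from below. A subgradient
  \<open>q\<close> of \<open>g\<close> at \<open>p\<close> gives the finite value at
  \<open>q\<close>, and the proximal point of 0 supplies such a pair.\<close>

lemma convex_conjugate_proper_fun:
  fixes g :: "'a::{real_inner,complete_space} \<Rightarrow> ereal"
  assumes "convex_fun g" "proper_fun g" "lsc_fun g"
  shows "proper_fun (convex_conjugate g)"
proof -
  obtain x r where r: "g x = ereal r"
    using assms(2) unfolding proper_fun_def by (metis real_of_ereal.elims)
  have "convex_conjugate g u \<noteq> -\<infinity>" for u
  proof -
    have "ereal (u \<bullet> x) - g x \<le> convex_conjugate g u" by (auto simp: convex_conjugate_def intro: SUP_upper)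
    then show ?thesis using r by auto
  qed
  moreover
  define p where "p = prox 1 g 0"
  define q where "q = (1 / 1) *\<^sub>R (0 - p)"
  have q: "q \<in> subdifferential g p" using prox_subgradient[OF assms, of 1 0] by (simp add: p_def q_def)
  then obtain s where s: "g p = ereal s" using subdifferential_finite[OF assms(2)] by auto
  have "convex_conjugate g q \<le> ereal (q \<bullet> p - s)"
    unfolding convex_conjugate_def
  proof (rule SUP_least)
    fix y
    have "g p + ereal (q \<bullet> (y - p)) \<le> g y" using q by (auto simp: subdifferential_def)
    then show "ereal (q \<bullet> y) - g y \<le> ereal (q \<bullet> p - s)"
      by (cases "g y") (auto simp: s inner_diff_right algebra_simps)
  qed
  then have "convex_conjugate g q \<noteq> \<infinity>" by auto
  ultimately show ?thesis by (auto simp: proper_fun_def)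
qed

section \<open>Riesz representation and adjoints\<close>

text \<open>The representing vector is the minimizer of \<open>\<parallel>z\<parallel>\<^sup>2 / 2 - \<phi> z\<close>.\<close>

lemma riesz_representation:
  fixes \<phi> :: "'a::{real_inner,complete_space} \<Rightarrow> real"
  assumes "bounded_linear \<phi>"
  shows "\<exists>p. \<forall>y. \<phi> y = p \<bullet> y"
proof -
  interpret bounded_linear \<phi> by (rule assms)
  define f where "f = (\<lambda>z. ereal (- \<phi> z))"
  have 1: "convex_fun f" by (auto simp: convex_fun_def f_def add scaleR)
  have 2: "proper_fun f" by (auto simp: proper_fun_def f_def)
  have 3: "lsc_fun f" unfolding lsc_fun_def
  proof
    fix x
    show "f x \<le> Liminf (at x) f"
    proof (cases "at x = bot")
      case False
      have "(f \<longlongrightarrow> f x) (at x)" unfolding f_def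
        by (intro tendsto_intros tendsto)
      then show ?thesis using False lim_imp_Liminf by fastforce
    qed (simp add: top_ereal_def)
  qed
  define p where "p = prox 1 f 0"
  have "- p \<in> subdifferential f p" using prox_subgradient[OF 1 2 3, of 1 0] by (simp add: p_def)
  then have *: "\<phi> (y - p) \<le> p \<bullet> (y - p)" for y
    by (auto simp: subdifferential_def f_def diff algebra_simps dest: spec[of _ y])
  \<comment> \<open>Testing at \<open>p + y\<close> and at \<open>p - y\<close> turns the inequality
    into an equality.\<close>
  have "\<phi> y = p \<bullet> y" for y
    using *[of "p + y"] *[of "p - y"] neg[of y] by simp
  then show ?thesis by blast
qed

text \<open>\<open>adjoint\<close> is chosen by its defining identity; the Riesz vectors of the
  functionals \<open>L x \<bullet> y\<close> show that a choice exists.\<close>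

lemma adjoint_inner:
  fixes L :: "'h::{real_inner,complete_space} \<Rightarrow> 'g::real_inner"
  assumes "bounded_linear L"
  shows "L x \<bullet> y = x \<bullet> adjoint L y"
proof -
  have "\<exists>p. \<forall>x. L x \<bullet> y = p \<bullet> x" for y
    by (intro riesz_representation bounded_linear_compose[OF bounded_linear_inner_left assms, of y, unfolded o_def])
  then have "\<exists>L'. \<forall>x y. L x \<bullet> y = x \<bullet> L' y" by (metis inner_commute)
  then show ?thesis unfolding adjoint_def by (rule someI2_ex) blast
qed

lemma linear_adjoint:
  fixes L :: "'h::{real_inner,complete_space} \<Rightarrow> 'g::real_inner"
  assumes "bounded_linear L"
  shows "linear (adjoint L)"
proof
  fix a b :: 'g and c :: real
  show "adjoint L (a + b) = adjoint L a + adjoint L b"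
    by (rule vector_eq_ldot[THEN iffD1]) (simp add: inner_add_right flip: adjoint_inner[OF assms])
  show "adjoint L (c *\<^sub>R a) = c *\<^sub>R adjoint L a"
    by (rule vector_eq_ldot[THEN iffD1]) (simp flip: adjoint_inner[OF assms])
qed

lemma norm_adjoint_le:
  fixes L :: "'h::{real_inner,complete_space} \<Rightarrow> 'g::real_inner"
  assumes "bounded_linear L"
  shows "norm (adjoint L v) \<le> onorm L * norm v"
proof -
  have "(norm (adjoint L v))\<^sup>2 = L (adjoint L v) \<bullet> v"
    by (simp add: adjoint_inner[OF assms] power2_norm_eq_inner)
  also have "\<dots> \<le> norm (L (adjoint L v)) * norm v" by (rule norm_cauchy_schwarz)
  also have "\<dots> \<le> (onorm L * norm (adjoint L v)) * norm v"
    by (intro mult_right_mono onorm assms) auto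
  finally have "norm (adjoint L v) * norm (adjoint L v) \<le> norm (adjoint L v) * (onorm L * norm v)"
    by (simp add: power2_eq_square mult_ac)
  then show ?thesis
    using onorm_pos_le[OF assms] by (cases "norm (adjoint L v) = 0") auto
qed

lemma bounded_linear_adjoint:
  fixes L :: "'h::{real_inner,complete_space} \<Rightarrow> 'g::real_inner"
  assumes "bounded_linear L"
  shows "bounded_linear (adjoint L)"
proof -
  interpret linear "adjoint L" by (rule linear_adjoint[OF assms])
  show ?thesis
    by (rule bounded_linear_intro[where K = "onorm L"])
      (use norm_adjoint_le[OF assms] in \<open>auto simp: add scale mult.commute\<close>)
qed

section \<open>Weak cluster points and Opial's lemma\<close>

text \<open>Filters instead of subsequences: the functionals \<open>\<lambda>w. z n \<bullet> w\<close> live in a product of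
  compact intervals, so Tychonoff's theorem supplies cluster points without separability.\<close>

lemma weak_cluster_filter:
  fixes z :: "nat \<Rightarrow> 'a::{real_inner,complete_space}"
  assumes "\<And>n. norm (z n) \<le> C" "F0 \<noteq> bot"
  shows "\<exists>F p. F \<noteq> bot \<and> F \<le> F0 \<and> (\<forall>w. ((\<lambda>n. z n \<bullet> w) \<longlongrightarrow> p \<bullet> w) F)"
proof -
  define \<Psi> where "\<Psi> = (\<lambda>n w. z n \<bullet> w)"
  define K where "K = PiE UNIV (\<lambda>w::'a. {- (C * norm w)..C * norm w})"
  have le: "\<bar>z n \<bullet> w\<bar> \<le> C * norm w" for n w
    using Cauchy_Schwarz_ineq2[of "z n" w] mult_right_mono[OF assms(1)[of n] norm_ge_zero[of w]] by linarith
  have "compactin (product_topology (\<lambda>_. euclidean) UNIV) K"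
    unfolding K_def by (subst compactin_PiE) auto
  then have "compact K" by (simp add: euclidean_product_topology)
  moreover have "eventually (\<lambda>g. g \<in> K) (filtermap \<Psi> F0)"
    using le by (auto simp: eventually_filtermap K_def \<Psi>_def PiE_UNIV_domain abs_le_iff minus_le_iff intro!: always_eventually)
  moreover have "filtermap \<Psi> F0 \<noteq> bot" using assms(2) by (simp add: filtermap_bot_iff)
  ultimately obtain \<phi> where \<phi>: "\<phi> \<in> K" "inf (nhds \<phi>) (filtermap \<Psi> F0) \<noteq> bot"
    unfolding compact_filter by blast
  \<comment> \<open>Indices are filtered by closeness of their functionals to \<open>\<phi>\<close>.
    The filter stays proper because \<open>\<phi>\<close> is a cluster point of the image of
    \<open>F0\<close>.\<close>
  define F where "F = inf (filtercomap \<Psi> (nhds \<phi>)) F0"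
  have "F \<noteq> bot"
  proof
    assume "F = bot"
    then have "eventually (\<lambda>_. False) F" by simp
    then obtain P Q where PQ: "eventually P (filtercomap \<Psi> (nhds \<phi>))" "eventually Q F0" "\<And>n. P n \<Longrightarrow> Q n \<Longrightarrow> False"
      unfolding F_def eventually_inf by blast
    then obtain R where R: "eventually R (nhds \<phi>)" "\<And>n. R (\<Psi> n) \<Longrightarrow> P n"
      by (auto simp: eventually_filtercomap)
    have "eventually (\<lambda>g. \<not> R g) (filtermap \<Psi> F0)"
      unfolding eventually_filtermap using PQ(2) by (rule eventually_mono) (use PQ(3) R(2) in blast)
    with R(1) have "eventually (\<lambda>_. False) (inf (nhds \<phi>) (filtermap \<Psi> F0))"
      unfolding eventually_inf by blast
    with \<phi>(2) show False by simp
  qed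
  have lim: "((\<lambda>n. z n \<bullet> w) \<longlongrightarrow> \<phi> w) F" for w
  proof -
    have "(\<Psi> \<longlongrightarrow> \<phi>) F" unfolding F_def
      by (intro filterlim_mono[OF filterlim_filtercomap]) auto
    then have "((\<lambda>n. \<Psi> n w) \<longlongrightarrow> \<phi> w) F"
      by (rule continuous_on_tendsto_compose[OF continuous_on_product_coordinates]) auto
    then show ?thesis by (simp add: \<Psi>_def)
  qed
  \<comment> \<open>Linearity passes to pointwise limits and the bound is membership in
    \<open>K\<close>, so Riesz turns \<open>\<phi>\<close> into a weak limit point.\<close>
  have "bounded_linear \<phi>"
  proof (rule bounded_linear_intro[where K = C])
    fix u v :: 'a and c :: real
    show "\<phi> (u + v) = \<phi> u + \<phi> v"
      using tendsto_add[OF lim lim, of u v] lim[of "u + v"] \<open>F \<noteq> bot\<close>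
      by (auto simp: inner_add_right intro: tendsto_unique)
    show "\<phi> (c *\<^sub>R u) = c *\<^sub>R \<phi> u"
      using tendsto_mult[OF tendsto_const lim, of c u] lim[of "c *\<^sub>R u"] \<open>F \<noteq> bot\<close>
      by (auto intro: tendsto_unique)
    show "norm (\<phi> u) \<le> norm u * C"
      using \<phi>(1) by (auto simp: K_def abs_le_iff mult.commute minus_le_iff PiE_UNIV_domain)
  qed
  then obtain p where "\<And>w. \<phi> w = p \<bullet> w" using riesz_representation by blast
  then have "\<forall>w. ((\<lambda>n. z n \<bullet> w) \<longlongrightarrow> p \<bullet> w) F" using lim by simp
  moreover have "F \<le> F0" by (simp add: F_def)
  ultimately show ?thesis using \<open>F \<noteq> bot\<close> by blast
qed

text \<open>The form of \<open>M\<close> replaces the squared norm in Opial's argument: cluster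
  points lie in \<open>S\<close>, so their distances to the sequence converge, which forces any two
  of them to coincide.\<close>

lemma opial_weakly_converges:
  fixes z :: "nat \<Rightarrow> 'a::{real_inner,complete_space}" and M :: "'a \<Rightarrow> 'a"
  assumes bdd: "\<And>n. norm (z n) \<le> C"
    and M: "linear M" "\<And>u v. M u \<bullet> v = u \<bullet> M v" "\<And>u. u \<noteq> 0 \<Longrightarrow> M u \<bullet> u > 0"
    and conv: "\<And>p. p \<in> S \<Longrightarrow> convergent (\<lambda>n. M (z n - p) \<bullet> (z n - p))"
    and cluster: "\<And>F p. F \<noteq> bot \<Longrightarrow> F \<le> sequentially \<Longrightarrow> (\<And>w. ((\<lambda>n. z n \<bullet> w) \<longlongrightarrow> p \<bullet> w) F) \<Longrightarrow> p \<in> S"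
  shows "\<exists>p\<in>S. weakly_converges z p"
proof -
  interpret linear M by (rule M(1))
  have unique: "p1 = p2" if F1: "F1 \<noteq> bot" "F1 \<le> sequentially" "\<And>w. ((\<lambda>n. z n \<bullet> w) \<longlongrightarrow> p1 \<bullet> w) F1"
    and F2: "F2 \<noteq> bot" "F2 \<le> sequentially" "\<And>w. ((\<lambda>n. z n \<bullet> w) \<longlongrightarrow> p2 \<bullet> w) F2" for F1 F2 p1 p2
  proof (rule ccontr)
    assume "p1 \<noteq> p2"
    obtain l1 where l1: "(\<lambda>n. M (z n - p1) \<bullet> (z n - p1)) \<longlonglongrightarrow> l1"
      using conv[OF cluster[OF F1]] by (auto simp: convergent_def)
    obtain l2 where l2: "(\<lambda>n. M (z n - p2) \<bullet> (z n - p2)) \<longlonglongrightarrow> l2"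
      using conv[OF cluster[OF F2]] by (auto simp: convergent_def)
    \<comment> \<open>The terms quadratic in \<open>z n\<close> cancel. Hence the pairing with
      \<open>M (p1 - p2)\<close> converges along the whole sequence and takes the same value at
      \<open>p1\<close> and \<open>p2\<close>.\<close>
    have eq: "M (z n - p2) \<bullet> (z n - p2) - M (z n - p1) \<bullet> (z n - p1) - M p2 \<bullet> p2 + M p1 \<bullet> p1
       = 2 * (z n \<bullet> M (p1 - p2))" for n
      by (simp add: diff inner_diff_left inner_diff_right M(2)) (simp add: inner_commute M(2)[symmetric])
    have "(\<lambda>n. 2 * (z n \<bullet> M (p1 - p2))) \<longlonglongrightarrow> l2 - l1 - M p2 \<bullet> p2 + M p1 \<bullet> p1"
      unfolding eq[symmetric] by (intro tendsto_intros l1 l2)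
    then have T: "((\<lambda>n. 2 * (z n \<bullet> M (p1 - p2))) \<longlongrightarrow> l2 - l1 - M p2 \<bullet> p2 + M p1 \<bullet> p1) F"
      if "F \<le> sequentially" for F using that by (rule tendsto_mono[rotated])
    have "2 * (p1 \<bullet> M (p1 - p2)) = l2 - l1 - M p2 \<bullet> p2 + M p1 \<bullet> p1"
      by (rule tendsto_unique[OF F1(1) tendsto_mult[OF tendsto_const F1(3)] T[OF F1(2)]])
    moreover have "2 * (p2 \<bullet> M (p1 - p2)) = l2 - l1 - M p2 \<bullet> p2 + M p1 \<bullet> p1"
      by (rule tendsto_unique[OF F2(1) tendsto_mult[OF tendsto_const F2(3)] T[OF F2(2)]])
    ultimately have "M (p1 - p2) \<bullet> (p1 - p2) = 0"
      by (simp add: inner_diff_left inner_diff_right inner_commute)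
    with M(3)[of "p1 - p2"] \<open>p1 \<noteq> p2\<close> show False by simp
  qed
  obtain F p where F: "F \<noteq> bot" "F \<le> sequentially" "\<And>w. ((\<lambda>n. z n \<bullet> w) \<longlongrightarrow> p \<bullet> w) F"
    using weak_cluster_filter[of z C sequentially] bdd by auto
  have "(\<lambda>n. z n \<bullet> w) \<longlonglongrightarrow> p \<bullet> w" for w
  proof (rule ccontr)
    assume "\<not> (\<lambda>n. z n \<bullet> w) \<longlonglongrightarrow> p \<bullet> w"
    then obtain e where e: "e > 0" "\<not> (\<forall>\<^sub>F n in sequentially. dist (z n \<bullet> w) (p \<bullet> w) < e)"
      by (auto simp: tendsto_iff)
    \<comment> \<open>The indices violating the limit have a weak cluster point of their own;
      uniqueness identifies it with \<open>p\<close>, which contradicts the violation.\<close>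
    define F0 where "F0 = inf sequentially (principal {n. \<not> dist (z n \<bullet> w) (p \<bullet> w) < e})"
    have "F0 \<noteq> bot"
      using e(2) by (auto simp: F0_def trivial_limit_def eventually_inf_principal)
    then obtain F' p' where F': "F' \<noteq> bot" "F' \<le> F0" "\<And>w. ((\<lambda>n. z n \<bullet> w) \<longlongrightarrow> p' \<bullet> w) F'"
      using weak_cluster_filter[of z C F0] bdd by auto
    have "F' \<le> sequentially" using F'(2) by (simp add: F0_def)
    then have "p' = p" using unique[OF F'(1) _ F'(3) F] by simp
    then have "\<forall>\<^sub>F n in F'. dist (z n \<bullet> w) (p \<bullet> w) < e"
      using F'(3) e(1) by (auto simp: tendsto_iff)
    moreover have "\<forall>\<^sub>F n in F'. \<not> dist (z n \<bullet> w) (p \<bullet> w) < e"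
      using F'(2) by (simp add: F0_def le_principal)
    ultimately have "\<forall>\<^sub>F n in F'. False" by eventually_elim simp
    with F'(1) show False by simp
  qed
  then have "weakly_converges z p" by (simp add: weakly_converges_def)
  with cluster[OF F] show ?thesis by blast
qed

section \<open>The Lyapunov inequality\<close>

text \<open>The quadratic form of the matrix with diagonal 1 and off-diagonal \<open>- r\<close>.
  With \<open>r = 1 - \<theta>\<close> it is the part of \<open>dissipation\<close> in which primal
  and dual differences do not mix.\<close>

definition correlated_square :: "real \<Rightarrow> 'a::real_inner \<Rightarrow> 'a \<Rightarrow> real" where
  "correlated_square r u v = u \<bullet> u + v \<bullet> v - 2 * r * (u \<bullet> v)"

text \<open>For \<open>r\<close> in [0, 1] this is a nonnegative combination of squared norms, so
  norm bounds of linear maps carry over to the form.\<close>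

lemma correlated_square_alt:
  "correlated_square r u v = (1 - r) * (u \<bullet> u + v \<bullet> v) + r * ((u - v) \<bullet> (u - v))"
  by (simp add: correlated_square_def algebra_simps inner_commute)

lemma correlated_square_lower:
  assumes "0 \<le> r" "r \<le> 1"
  shows "(1 - r) * (u \<bullet> u) \<le> correlated_square r u v" "0 \<le> correlated_square r u v"
  using assms by (simp_all add: correlated_square_alt distrib_left)

text \<open>The shift is, up to the factor \<open>t * (1 - r^2)\<close>, the inverse matrix applied
  to \<open>(v, w)\<close>; this makes the cross term proportional to
  \<open>a \<bullet> v + b \<bullet> w\<close>.\<close>

lemma correlated_square_complete:
  "correlated_square r (a - t *\<^sub>R (v + r *\<^sub>R w)) (b - t *\<^sub>R (r *\<^sub>R v + w))
    = correlated_square r a b - 2 * t * (1 - r\<^sup>2) * (a \<bullet> v + b \<bullet> w)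
      + t\<^sup>2 * (1 - r\<^sup>2) * correlated_square (- r) v w"
  by (simp add: correlated_square_def inner_add_left inner_add_right inner_diff_left inner_diff_right inner_commute)
    (simp add: algebra_simps power2_eq_square)

locale chambolle_pock_parameters =
  fixes L :: "'h::{real_inner,complete_space} \<Rightarrow> 'g::{real_inner,complete_space}"
    and \<tau> \<sigma> \<theta> :: real
  assumes bounded_linear_L: "bounded_linear L"
    and tau_pos: "\<tau> > 0" and sigma_pos: "\<sigma> > 0"
    and theta_pos: "0 < \<theta>" and theta_less_1: "\<theta> < 1"
    and step: "\<tau> * \<sigma> * (onorm L)\<^sup>2 < 4 * \<theta> * (2 - \<theta>) / (1 - 2 * \<theta> + 9 * \<theta>^2 - 4 * \<theta>^3)"
begin

interpretation L: bounded_linear L by (rule bounded_linear_L)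

section \<open>Positivity of the step metric under the step-size bound\<close>

lemma inner_adjoint: "u \<bullet> adjoint L v = L u \<bullet> v" "adjoint L v \<bullet> u = L u \<bullet> v"
  using adjoint_inner[OF bounded_linear_L, of u v] by (simp_all add: inner_commute)

lemma denominator_pos: "0 < 1 - 2 * \<theta> + 9 * \<theta>^2 - 4 * \<theta>^3"
proof -
  have "1 - 2 * \<theta> + 9 * \<theta>^2 - 4 * \<theta>^3 = (1 - \<theta>)\<^sup>2 + 4 * \<theta>\<^sup>2 * (2 - \<theta>)"
    by (simp add: algebra_simps power2_eq_square power3_eq_cube)
  moreover have "0 < (1 - \<theta>)\<^sup>2" "0 \<le> 4 * \<theta>\<^sup>2 * (2 - \<theta>)" using theta_less_1 by auto
  ultimately show ?thesis by linarith
qed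

definition step_metric :: "'h \<Rightarrow> 'g \<Rightarrow> real" where
  "step_metric u v = u \<bullet> u / \<tau> + v \<bullet> v / \<sigma> - (1 + \<theta>) * (L u \<bullet> v)"

text \<open>Positive definiteness follows from
  \<open>\<tau> * \<sigma> * (onorm L)^2 * \<kappa>^2 < 1\<close>. The step-size bound implies this
  because the denominator exceeds \<open>4 * \<theta> * (2 - \<theta>) * \<kappa>^2\<close> by
  \<open>(1 - \<theta>)^4\<close>.\<close>

lemma step_metric_lower_bound:
  obtains \<mu> where "\<mu> > 0" "\<And>u v. \<mu> * (u \<bullet> u + v \<bullet> v) \<le> step_metric u v"
proof -
  define \<kappa> where "\<kappa> = (1 + \<theta>) / 2"
  \<comment> \<open>In the scaled norms \<open>s\<close>, \<open>t\<close> below, the coupling term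
    is at most \<open>2 * q * (s * t)\<close>.\<close>
  define q where "q = sqrt (\<tau> * \<sigma> * (onorm L)\<^sup>2 * \<kappa>\<^sup>2)"
  let ?D = "1 - 2 * \<theta> + 9 * \<theta>^2 - 4 * \<theta>^3"
  have "4 * \<theta> * (2 - \<theta>) * \<kappa>\<^sup>2 \<le> ?D"
  proof -
    have "?D - 4 * \<theta> * (2 - \<theta>) * \<kappa>\<^sup>2 = (1 - \<theta>)^4"
      by (simp add: \<kappa>_def field_simps) (simp add: algebra_simps power2_eq_square power3_eq_cube power4_eq_xxxx)
    moreover have "0 \<le> (1 - \<theta>)^4" by simp
    ultimately show ?thesis by linarith
  qed
  then have "4 * \<theta> * (2 - \<theta>) / ?D * \<kappa>\<^sup>2 \<le> 1" using denominator_pos by (simp add: divide_simps)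
  moreover have "\<tau> * \<sigma> * (onorm L)\<^sup>2 * \<kappa>\<^sup>2 < 4 * \<theta> * (2 - \<theta>) / ?D * \<kappa>\<^sup>2"
    using step theta_pos by (intro mult_strict_right_mono) (auto simp: \<kappa>_def)
  ultimately have q: "0 \<le> q" "q < 1" using tau_pos sigma_pos by (auto simp: q_def)
  define \<mu> where "\<mu> = (1 - q) * min (1 / \<tau>) (1 / \<sigma>)"
  have "\<mu> * (u \<bullet> u + v \<bullet> v) \<le> step_metric u v" for u v
  proof -
    define s t where "s = norm u / sqrt \<tau>" and "t = norm v / sqrt \<sigma>"
    have st: "s\<^sup>2 = u \<bullet> u / \<tau>" "t\<^sup>2 = v \<bullet> v / \<sigma>"
      using tau_pos sigma_pos by (simp_all add: s_def t_def power_divide power2_norm_eq_inner)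
    have "L u \<bullet> v \<le> onorm L * norm u * norm v"
      using norm_cauchy_schwarz[of "L u" v] mult_right_mono[OF onorm[OF bounded_linear_L, of u] norm_ge_zero[of v]] by linarith
    then have "(1 + \<theta>) * (L u \<bullet> v) \<le> (1 + \<theta>) * (onorm L * norm u * norm v)"
      using theta_pos by (intro mult_left_mono) auto
    also have "\<dots> = 2 * q * (s * t)"
    proof -
      have "q = sqrt \<tau> * sqrt \<sigma> * onorm L * \<kappa>"
        using theta_pos onorm_pos_le[OF bounded_linear_L] by (simp add: q_def \<kappa>_def real_sqrt_mult)
      then have "2 * q = sqrt \<tau> * sqrt \<sigma> * onorm L * (1 + \<theta>)" by (simp add: \<kappa>_def)
      then show ?thesis using tau_pos sigma_pos by (simp only:) (simp add: s_def t_def)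
    qed
    also have "\<dots> \<le> q * (s\<^sup>2 + t\<^sup>2)"
    proof -
      have "0 \<le> q * (s - t)\<^sup>2" using q by simp
      then show ?thesis by (simp add: power2_eq_square algebra_simps)
    qed
    finally have "(1 - q) * (s\<^sup>2 + t\<^sup>2) \<le> step_metric u v" unfolding step_metric_def st
      by (simp add: algebra_simps add_divide_distrib diff_divide_distrib)
    moreover have "min (1 / \<tau>) (1 / \<sigma>) * (u \<bullet> u) \<le> 1 / \<tau> * (u \<bullet> u)" "min (1 / \<tau>) (1 / \<sigma>) * (v \<bullet> v) \<le> 1 / \<sigma> * (v \<bullet> v)"
      by (intro mult_right_mono; simp)+
    then have "min (1 / \<tau>) (1 / \<sigma>) * (u \<bullet> u + v \<bullet> v) \<le> s\<^sup>2 + t\<^sup>2" by (simp add: st distrib_left)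
    then have "\<mu> * (u \<bullet> u + v \<bullet> v) \<le> (1 - q) * (s\<^sup>2 + t\<^sup>2)"
      unfolding \<mu>_def mult.assoc using q by (intro mult_left_mono) auto
    ultimately show ?thesis by linarith
  qed
  moreover have "\<mu> > 0" using q tau_pos sigma_pos by (simp add: \<mu>_def)
  ultimately show ?thesis using that by blast
qed

text \<open>The pair \<open>a\<close>, \<open>c\<close> is the earlier difference and
  \<open>b\<close>, \<open>d\<close> the later one. The term with \<open>L a \<bullet> d\<close>
  stems from the extrapolation, the one with \<open>L b \<bullet> c\<close> from the primal step
  using the old dual iterate.\<close>

definition dissipation :: "'h \<Rightarrow> 'g \<Rightarrow> 'h \<Rightarrow> 'g \<Rightarrow> real" where
  "dissipation a c b d = step_metric a c + step_metric b d
    - 2 * (1 - \<theta>) * (a \<bullet> b / \<tau> + c \<bullet> d / \<sigma> - L b \<bullet> c - \<theta> * (L a \<bullet> d))"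

text \<open>Here \<open>x\<^sub>i\<close>, \<open>y\<^sub>i\<close> are measured from a saddle point and \<open>f\<^sub>i\<close>, \<open>g\<^sub>i\<close> are the parts of the
  gap function. The subgradient inequalities at step 2 tested at the saddle point enter with
  weight 2, those at step 1 tested at step 2 with weight \<open>1 - \<theta>\<close>: this choice makes the
  bilinear terms that still contain the saddle point telescope.\<close>

lemma lyapunov_step:
  assumes p1: "p1 = (1 / \<tau>) *\<^sub>R (x0 - x1) - adjoint L y0"
    and p2: "p2 = (1 / \<tau>) *\<^sub>R (x1 - x2) - adjoint L y1"
    and q1: "q1 = (1 / \<sigma>) *\<^sub>R (y0 - y1) + L (x1 + \<theta> *\<^sub>R (x1 - x0))"
    and q2: "q2 = (1 / \<sigma>) *\<^sub>R (y1 - y2) + L (x2 + \<theta> *\<^sub>R (x2 - x1))"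
    and le: "f2 \<le> p2 \<bullet> x2" "g2 \<le> q2 \<bullet> y2" "f1 + p1 \<bullet> (x2 - x1) \<le> f2" "g1 + q1 \<bullet> (y2 - y1) \<le> g2"
  shows "step_metric x2 y2 + step_metric (x2 - x1) (y2 - y1) / 2 + (1 + \<theta>) * (f2 + g2)
    \<le> step_metric x1 y1 + step_metric (x1 - x0) (y1 - y0) / 2 + (1 + \<theta>) * (f1 + g1)
      - 2 * (f1 + g1) - dissipation (x1 - x0) (y1 - y0) (x2 - x1) (y2 - y1) / 2"
proof -
  \<comment> \<open>With a weight \<open>w\<close> in place of \<open>1 - \<theta>\<close>, the
    coefficients of \<open>L x1 \<bullet> (y2 - y1)\<close> and
    \<open>L (x2 - x1) \<bullet> y1\<close> on the left are \<open>2 - w\<close> and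
    \<open>2 * \<theta> + w\<close>. They agree for \<open>w = 1 - \<theta>\<close>, with value
    \<open>1 + \<theta>\<close>, the coupling in \<open>step_metric\<close>.\<close>
  have "2 * (p2 \<bullet> x2 + q2 \<bullet> y2) - (1 - \<theta>) * (p1 \<bullet> (x2 - x1) + q1 \<bullet> (y2 - y1))
    = step_metric x1 y1 + step_metric (x1 - x0) (y1 - y0) / 2 - step_metric x2 y2 - step_metric (x2 - x1) (y2 - y1) / 2
      - dissipation (x1 - x0) (y1 - y0) (x2 - x1) (y2 - y1) / 2"
    unfolding p1 p2 q1 q2 dissipation_def step_metric_def
    by (simp add: inner_add_left inner_add_right inner_diff_left inner_diff_right L.add L.diff L.scaleR
        inner_adjoint inner_commute add_divide_distrib diff_divide_distrib)
      (simp add: algebra_simps add_divide_distrib diff_divide_distrib)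
  \<comment> \<open>This fixes the gap coefficients:
    \<open>2 - (1 - \<theta>) = 1 + \<theta>\<close> at step 2 and
    \<open>- (1 - \<theta>) = (1 + \<theta>) - 2\<close> at step 1.\<close>
  moreover have "(1 - \<theta>) * (f1 + g1 + (p1 \<bullet> (x2 - x1) + q1 \<bullet> (y2 - y1))) \<le> (1 - \<theta>) * (f2 + g2)"
    using le theta_less_1 by (intro mult_left_mono) auto
  ultimately show ?thesis using le(1,2) by (simp add: algebra_simps)
qed

text \<open>Minimizing over \<open>a\<close> and \<open>b\<close> leaves \<open>Q(c, d) / \<sigma> - (\<tau> / \<rho>) Q(L\<^sup>* c, L\<^sup>* d)\<close>, where \<open>Q\<close> is
  \<open>correlated_square (1 - \<theta>)\<close> and \<open>\<rho>\<close> is the bound on \<open>\<tau> \<sigma> \<parallel>L\<parallel>\<^sup>2\<close>.\<close>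

lemma dissipation_lower_bound:
  obtains \<delta> and A :: "'g \<Rightarrow> 'g \<Rightarrow> 'h"
  where "\<delta> > 0"
    and "\<And>a c b d. \<delta> * (c \<bullet> c) \<le> dissipation a c b d"
    and "\<And>a c b d. \<delta> * ((a - A c d) \<bullet> (a - A c d)) \<le> dissipation a c b d"
    and "\<And>a c b d. 0 \<le> dissipation a c b d"
    and "\<And>F c d. (c \<longlongrightarrow> 0) F \<Longrightarrow> (d \<longlongrightarrow> 0) F \<Longrightarrow> ((\<lambda>n::nat. A (c n) (d n)) \<longlongrightarrow> 0) F"
proof -
  define r where "r = 1 - \<theta>"
  define \<kappa> where "\<kappa> = (1 + \<theta>) / 2"
  define D where "D = 1 - 2 * \<theta> + 9 * \<theta>^2 - 4 * \<theta>^3"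
  define \<rho> where "\<rho> = 4 * \<theta> * (2 - \<theta>) / D"
  define t where "t = \<tau> / (\<theta> * (2 - \<theta>))"
  \<comment> \<open>The mixed primal-dual terms of \<open>dissipation\<close> are
    \<open>- 2 * (a \<bullet> V c d + b \<bullet> W c d)\<close>.\<close>
  define V W where "V = (\<lambda>c d. \<kappa> *\<^sub>R adjoint L c - (r * \<theta>) *\<^sub>R adjoint L d)"
    and "W = (\<lambda>c d. \<kappa> *\<^sub>R adjoint L d - r *\<^sub>R adjoint L c)"
  \<comment> \<open>For fixed \<open>c\<close>, \<open>d\<close> these are the minimizing
    \<open>a\<close> and \<open>b\<close>.\<close>
  define A B where "A = (\<lambda>c d. t *\<^sub>R (V c d + r *\<^sub>R W c d))" and "B = (\<lambda>c d. t *\<^sub>R (r *\<^sub>R V c d + W c d))"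
  have r: "0 \<le> r" "r < 1" using theta_pos theta_less_1 by (auto simp: r_def)
  have D: "D > 0" using denominator_pos by (simp add: D_def)
  have \<rho>: "\<rho> > 0" using D theta_pos theta_less_1 by (simp add: \<rho>_def)
  have r2: "1 - r\<^sup>2 = \<theta> * (2 - \<theta>)" by (simp add: r_def power2_eq_square algebra_simps)
  have t: "t * (1 - r\<^sup>2) = \<tau>" using theta_pos theta_less_1 by (simp add: t_def r2)
  \<comment> \<open>The denominator of the step-size bound originates here: both squared terms get
    the coefficient \<open>\<kappa>^2 - \<theta> * r^2 = D / 4\<close>.\<close>
  have VW: "correlated_square (- r) (V c d) (W c d) = D / 4 * correlated_square r (adjoint L c) (adjoint L d)" for c d
    unfolding correlated_square_def V_def W_def D_def r_def \<kappa>_def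
    by (simp add: inner_diff_left inner_diff_right inner_commute)
      (simp add: field_simps power2_eq_square power3_eq_cube)
  have eq: "dissipation a c b d = correlated_square r (a - A c d) (b - B c d) / \<tau>
    + correlated_square r c d / \<sigma> - \<tau> / \<rho> * correlated_square r (adjoint L c) (adjoint L d)" for a c b d
  proof -
    have "correlated_square r (a - A c d) (b - B c d) = correlated_square r a b
      - 2 * \<tau> * (a \<bullet> V c d + b \<bullet> W c d) + t * \<tau> * (D / 4 * correlated_square r (adjoint L c) (adjoint L d))"
      unfolding A_def B_def correlated_square_complete VW t[symmetric]
      by (simp add: power2_eq_square)
    moreover have "t * (D / 4) = \<tau> / \<rho>" by (simp add: t_def \<rho>_def)
    then have "t * \<tau> * (D / 4 * X) = \<tau> * (\<tau> / \<rho> * X)" for X by (metis mult.assoc mult.left_commute)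
    ultimately have "correlated_square r (a - A c d) (b - B c d) / \<tau> = correlated_square r a b / \<tau>
      - 2 * (a \<bullet> V c d + b \<bullet> W c d) + \<tau> / \<rho> * correlated_square r (adjoint L c) (adjoint L d)"
      using tau_pos by (simp add: add_divide_distrib diff_divide_distrib)
    moreover have "dissipation a c b d = correlated_square r a b / \<tau> + correlated_square r c d / \<sigma>
      - 2 * (a \<bullet> V c d + b \<bullet> W c d)"
      unfolding dissipation_def step_metric_def correlated_square_def V_def W_def r_def \<kappa>_def
      by (simp add: inner_diff_left inner_diff_right inner_adjoint add_divide_distrib diff_divide_distrib)
        (simp add: algebra_simps add_divide_distrib diff_divide_distrib)
    ultimately show ?thesis by simp
  qed
  have adj: "adjoint L v \<bullet> adjoint L v \<le> (onorm L)\<^sup>2 * (v \<bullet> v)" for v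
    using power_mono[OF norm_adjoint_le[OF bounded_linear_L, of v], of 2]
    by (simp add: power_mult_distrib power2_norm_eq_inner)
  interpret adj: linear "adjoint L" by (rule linear_adjoint[OF bounded_linear_L])
  have cs_adj: "correlated_square r (adjoint L c) (adjoint L d) \<le> (onorm L)\<^sup>2 * correlated_square r c d" for c d
  proof -
    have "(1 - r) * (adjoint L c \<bullet> adjoint L c + adjoint L d \<bullet> adjoint L d) \<le> (1 - r) * ((onorm L)\<^sup>2 * (c \<bullet> c) + (onorm L)\<^sup>2 * (d \<bullet> d))"
      using r adj by (intro mult_left_mono add_mono) auto
    moreover have "r * (adjoint L (c - d) \<bullet> adjoint L (c - d)) \<le> r * ((onorm L)\<^sup>2 * ((c - d) \<bullet> (c - d)))"
      using r adj by (intro mult_left_mono) auto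
    ultimately show ?thesis unfolding correlated_square_alt adj.diff[symmetric]
      by (simp add: distrib_left mult_ac)
  qed
  \<comment> \<open>Positivity of \<open>\<epsilon>\<close> is the step-size condition divided by
    \<open>\<sigma> * \<rho>\<close>.\<close>
  define \<epsilon> where "\<epsilon> = 1 / \<sigma> - \<tau> / \<rho> * (onorm L)\<^sup>2"
  have \<epsilon>: "\<epsilon> > 0"
    using step tau_pos sigma_pos \<rho> unfolding D_def[symmetric] \<rho>_def[symmetric] \<epsilon>_def by (simp add: field_simps)
  have low: "correlated_square r (a - A c d) (b - B c d) / \<tau> + \<epsilon> * correlated_square r c d \<le> dissipation a c b d" for a c b d
  proof -
    have "\<tau> / \<rho> * correlated_square r (adjoint L c) (adjoint L d) \<le> \<tau> / \<rho> * ((onorm L)\<^sup>2 * correlated_square r c d)"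
      using tau_pos \<rho> by (intro mult_left_mono cs_adj) auto
    then show ?thesis unfolding eq \<epsilon>_def by (simp add: algebra_simps)
  qed
  note cs = correlated_square_lower[OF r(1) less_imp_le[OF r(2)]]
  define \<delta> where "\<delta> = (1 - r) * min \<epsilon> (1 / \<tau>)"
  have \<delta>: "\<delta> \<le> (1 - r) * \<epsilon>" "\<delta> \<le> (1 - r) * (1 / \<tau>)" "\<delta> > 0"
    unfolding \<delta>_def using r \<epsilon> tau_pos by (intro mult_left_mono mult_pos_pos; simp)+
  have \<delta>_eps: "\<delta> * s \<le> \<epsilon> * S" if "(1 - r) * s \<le> S" "0 \<le> s" for s S
    using mult_right_mono[OF \<delta>(1) that(2)] mult_left_mono[OF that(1), of \<epsilon>] \<epsilon> by (simp add: algebra_simps)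
  have \<delta>_tau: "\<delta> * s \<le> S / \<tau>" if "(1 - r) * s \<le> S" "0 \<le> s" for s S
    using mult_right_mono[OF \<delta>(2) that(2)] mult_left_mono[OF that(1), of "1 / \<tau>"] tau_pos by (simp add: algebra_simps diff_divide_distrib)
  have nonneg: "0 \<le> correlated_square r (a - A c d) (b - B c d) / \<tau>" "0 \<le> \<epsilon> * correlated_square r c d" for a b c d
    using cs(2)[of "a - A c d" "b - B c d"] cs(2)[of c d] \<epsilon> tau_pos by simp_all
  show ?thesis
  proof (rule that[of \<delta> A])
    show "\<delta> > 0" by (rule \<delta>(3))
    fix a c b d
    show "\<delta> * (c \<bullet> c) \<le> dissipation a c b d"
      using \<delta>_eps[OF cs(1)[of c d]] low[of a c d b] nonneg(1)[of a c d b] by simp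
    show "\<delta> * ((a - A c d) \<bullet> (a - A c d)) \<le> dissipation a c b d"
      using \<delta>_tau[OF cs(1)[of "a - A c d" "b - B c d"]] low[of a c d b] nonneg(2)[of c d] by simp
    show "0 \<le> dissipation a c b d"
      using low[of a c d b] nonneg(1)[of a c d b] nonneg(2)[of c d] by linarith
  next
    fix F and c d :: "nat \<Rightarrow> 'g"
    assume "(c \<longlongrightarrow> 0) F" "(d \<longlongrightarrow> 0) F"
    have "((\<lambda>n. A (c n) (d n)) \<longlongrightarrow> A 0 0) F"
      unfolding A_def V_def W_def
      by (intro tendsto_intros bounded_linear.tendsto[OF bounded_linear_adjoint[OF bounded_linear_L]] \<open>(c \<longlongrightarrow> 0) F\<close> \<open>(d \<longlongrightarrow> 0) F\<close>)
    then show "((\<lambda>n. A (c n) (d n)) \<longlongrightarrow> 0) F" by (simp add: A_def V_def W_def)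
  qed
qed

end

section \<open>Convergence of the iteration\<close>

lemma tendsto_inner_bounded:
  assumes "(R \<longlongrightarrow> 0) F" "\<And>n. norm (w n) \<le> C"
  shows "((\<lambda>n. R n \<bullet> w n) \<longlongrightarrow> 0) F"
proof (rule Lim_null_comparison)
  show "\<forall>\<^sub>F n in F. norm (R n \<bullet> w n) \<le> norm (R n) * C"
  proof (rule always_eventually, rule allI)
    fix n
    have "norm (R n \<bullet> w n) \<le> norm (R n) * norm (w n)" using Cauchy_Schwarz_ineq2 by simp
    also have "\<dots> \<le> norm (R n) * C" using assms(2) by (intro mult_left_mono) auto
    finally show "norm (R n \<bullet> w n) \<le> norm (R n) * C" .
  qed
  show "((\<lambda>n. norm (R n) * C) \<longlongrightarrow> 0) F"
    using tendsto_mult[OF tendsto_norm[OF assms(1)] tendsto_const, of C] by simp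
qed

lemma tendsto_zero_inner_self:
  assumes "((\<lambda>n. w n \<bullet> w n) \<longlongrightarrow> 0) F"
  shows "(w \<longlongrightarrow> 0) F"
proof (rule tendsto_norm_zero_cancel)
  show "((\<lambda>n. norm (w n)) \<longlongrightarrow> 0) F"
    using tendsto_real_sqrt[OF assms] by (simp add: norm_eq_sqrt_inner)
qed

text \<open>\<open>h\<close> stands for the conjugate of \<open>g\<close>, the function in the dual
  proximal step.\<close>

locale chambolle_pock_iteration = chambolle_pock_parameters L \<tau> \<sigma> \<theta>
  for L :: "'h::{real_inner,complete_space} \<Rightarrow> 'g::{real_inner,complete_space}"
    and \<tau> \<sigma> \<theta> :: real +
  fixes f :: "'h \<Rightarrow> ereal" and h :: "'g \<Rightarrow> ereal" and x :: "nat \<Rightarrow> 'h" and y :: "nat \<Rightarrow> 'g"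
  assumes f: "convex_fun f" "proper_fun f" "lsc_fun f"
    and h: "convex_fun h" "proper_fun h" "lsc_fun h"
    and x_Suc: "x (Suc k) = prox \<tau> f (x k - \<tau> *\<^sub>R adjoint L (y k))"
    and y_Suc: "y (Suc k) = prox \<sigma> h (y k + \<sigma> *\<^sub>R L (x (Suc k) + \<theta> *\<^sub>R (x (Suc k) - x k)))"
begin

interpretation L: bounded_linear L by (rule bounded_linear_L)
interpretation adj: linear "adjoint L" by (rule linear_adjoint[OF bounded_linear_L])

text \<open>The subgradients that the proximal steps produce. The index is that of the old iterate:
  \<open>p k\<close> and \<open>q k\<close> belong to the points with index
  \<open>Suc k\<close>.\<close>

definition p where "p k = (1 / \<tau>) *\<^sub>R (x k - x (Suc k)) - adjoint L (y k)"
definition q where "q k = (1 / \<sigma>) *\<^sub>R (y k - y (Suc k)) + L (x (Suc k) + \<theta> *\<^sub>R (x (Suc k) - x k))"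

lemma p_subgradient: "p k \<in> subdifferential f (x (Suc k))"
proof -
  have "p k = (1 / \<tau>) *\<^sub>R (x k - \<tau> *\<^sub>R adjoint L (y k) - x (Suc k))"
    using tau_pos by (simp add: p_def algebra_simps)
  then show ?thesis using prox_subgradient[OF f tau_pos] by (simp add: x_Suc)
qed

lemma q_subgradient: "q k \<in> subdifferential h (y (Suc k))"
proof -
  define e where "e = L (x (Suc k) + \<theta> *\<^sub>R (x (Suc k) - x k))"
  have "q k = (1 / \<sigma>) *\<^sub>R (y k + \<sigma> *\<^sub>R e - y (Suc k))"
    unfolding q_def e_def[symmetric] using sigma_pos by (simp add: algebra_simps)
  then show ?thesis using prox_subgradient[OF h sigma_pos, of "y k + \<sigma> *\<^sub>R e"]
    by (simp add: y_Suc flip: e_def)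
qed

text \<open>The energy \<open>E\<close> is nonnegative and decreasing, so its drops vanish and take
  the gap and the dissipation with them. What remains of \<open>E\<close> in the limit is the metric
  distance to the saddle point.\<close>

lemma fejer_convergence:
  assumes "- adjoint L ys \<in> subdifferential f xs" "L xs \<in> subdifferential h ys"
  shows "(\<lambda>k. x (Suc k) - x k) \<longlonglongrightarrow> 0" (is ?X)
    and "(\<lambda>k. y (Suc k) - y k) \<longlonglongrightarrow> 0" (is ?Y)
    and "convergent (\<lambda>k. step_metric (x k - xs) (y k - ys))" (is ?C)
proof -
  define a c where "a = (\<lambda>k. x (Suc k) - x k)" and "c = (\<lambda>k. y (Suc k) - y k)"
  \<comment> \<open>The gap starts at index \<open>Suc k\<close> because \<open>x 0\<close> is
    arbitrary and \<open>f\<close> may be infinite there; the same holds for \<open>G\<close> and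
    \<open>y 0\<close>.\<close>
  define F where "F = (\<lambda>k. real_of_ereal (f (x (Suc k))) - real_of_ereal (f xs) + adjoint L ys \<bullet> (x (Suc k) - xs))"
  define G where "G = (\<lambda>k. real_of_ereal (h (y (Suc k))) - real_of_ereal (h ys) - L xs \<bullet> (y (Suc k) - ys))"
  define E where "E = (\<lambda>k. step_metric (x (Suc k) - xs) (y (Suc k) - ys) + step_metric (a k) (c k) / 2 + (1 + \<theta>) * (F k + G k))"
  define d where "d = (\<lambda>k. dissipation (a k) (c k) (a (Suc k)) (c (Suc k)))"
  note fin = subdifferential_finite[OF f(2) assms(1)] subdifferential_finite[OF h(2) assms(2)]
    subdifferential_finite[OF f(2) p_subgradient] subdifferential_finite[OF h(2) q_subgradient]
  have F: "0 \<le> F k" for k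
    using subdifferential_real[OF f(2) assms(1) fin(3)[of k]] by (simp add: F_def)
  have G: "0 \<le> G k" for k
    using subdifferential_real[OF h(2) assms(2) fin(4)[of k]] by (simp add: G_def)
  obtain \<mu> where \<mu>: "\<mu> > 0" "\<And>u v. \<mu> * (u \<bullet> u + v \<bullet> v) \<le> step_metric u v"
    by (rule step_metric_lower_bound) blast
  have metric_nonneg: "0 \<le> step_metric u v" for u v
    using order_trans[OF _ \<mu>(2)[of u v]] \<mu>(1) by simp
  obtain \<delta> and A :: "'g \<Rightarrow> 'g \<Rightarrow> 'h" where \<delta>: "\<delta> > 0"
    "\<And>a c b d. \<delta> * (c \<bullet> c) \<le> dissipation a c b d"
    "\<And>a c b d. \<delta> * ((a - A c d) \<bullet> (a - A c d)) \<le> dissipation a c b d"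
    "\<And>a c b d. 0 \<le> dissipation a c b d"
    and A: "\<And>F c d. (c \<longlongrightarrow> 0) F \<Longrightarrow> (d \<longlongrightarrow> 0) F \<Longrightarrow> ((\<lambda>n::nat. A (c n) (d n)) \<longlongrightarrow> 0) F"
    by (rule dissipation_lower_bound) blast
  have E_Suc: "E (Suc k) \<le> E k - 2 * (F k + G k) - d k / 2" for k
  proof -
    have "step_metric (x (Suc (Suc k)) - xs) (y (Suc (Suc k)) - ys)
        + step_metric (x (Suc (Suc k)) - xs - (x (Suc k) - xs)) (y (Suc (Suc k)) - ys - (y (Suc k) - ys)) / 2
        + (1 + \<theta>) * (F (Suc k) + G (Suc k))
      \<le> step_metric (x (Suc k) - xs) (y (Suc k) - ys)
        + step_metric (x (Suc k) - xs - (x k - xs)) (y (Suc k) - ys - (y k - ys)) / 2 + (1 + \<theta>) * (F k + G k)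
        - 2 * (F k + G k)
        - dissipation (x (Suc k) - xs - (x k - xs)) (y (Suc k) - ys - (y k - ys))
            (x (Suc (Suc k)) - xs - (x (Suc k) - xs)) (y (Suc (Suc k)) - ys - (y (Suc k) - ys)) / 2"
    \<comment> \<open>Iterates are translated by the saddle point and subgradients by its optimality
      conditions, which leaves the recursion unchanged.\<close>
    proof (rule lyapunov_step)
      show "p k + adjoint L ys = (1 / \<tau>) *\<^sub>R (x k - xs - (x (Suc k) - xs)) - adjoint L (y k - ys)"
        "p (Suc k) + adjoint L ys = (1 / \<tau>) *\<^sub>R (x (Suc k) - xs - (x (Suc (Suc k)) - xs)) - adjoint L (y (Suc k) - ys)"
        by (simp_all add: p_def adj.diff)
      show "q k - L xs = (1 / \<sigma>) *\<^sub>R (y k - ys - (y (Suc k) - ys)) + L (x (Suc k) - xs + \<theta> *\<^sub>R (x (Suc k) - xs - (x k - xs)))"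
        "q (Suc k) - L xs = (1 / \<sigma>) *\<^sub>R (y (Suc k) - ys - (y (Suc (Suc k)) - ys))
          + L (x (Suc (Suc k)) - xs + \<theta> *\<^sub>R (x (Suc (Suc k)) - xs - (x (Suc k) - xs)))"
        by (simp_all add: q_def L.diff L.add)
      show "F (Suc k) \<le> (p (Suc k) + adjoint L ys) \<bullet> (x (Suc (Suc k)) - xs)"
        using subdifferential_real[OF f(2) p_subgradient[of "Suc k"] fin(1)]
        by (simp add: F_def inner_add_left inner_diff_right)
      show "G (Suc k) \<le> (q (Suc k) - L xs) \<bullet> (y (Suc (Suc k)) - ys)"
        using subdifferential_real[OF h(2) q_subgradient[of "Suc k"] fin(2)]
        by (simp add: G_def inner_diff_left inner_diff_right)
      show "F k + (p k + adjoint L ys) \<bullet> (x (Suc (Suc k)) - xs - (x (Suc k) - xs)) \<le> F (Suc k)"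
        using subdifferential_real[OF f(2) p_subgradient[of k] fin(3)[of "Suc k"]]
        by (simp add: F_def inner_add_left inner_diff_right)
      show "G k + (q k - L xs) \<bullet> (y (Suc (Suc k)) - ys - (y (Suc k) - ys)) \<le> G (Suc k)"
        using subdifferential_real[OF h(2) q_subgradient[of k] fin(4)[of "Suc k"]]
        by (simp add: G_def inner_diff_left inner_diff_right)
    qed
    then show ?thesis by (simp add: E_def d_def a_def c_def)
  qed
  have d: "0 \<le> d k" for k by (simp add: d_def \<delta>(4))
  have E: "0 \<le> E k" for k
    using metric_nonneg F[of k] G[of k] theta_pos by (simp add: E_def)
  have "decseq E"
  proof (rule decseq_SucI)
    show "E (Suc k) \<le> E k" for k using E_Suc[of k] F[of k] G[of k] d[of k] by argo
  qed
  then obtain e where e: "E \<longlonglongrightarrow> e" using decseq_convergent[of E 0] E by metis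
  have drop: "(\<lambda>k. E k - E (Suc k)) \<longlonglongrightarrow> 0" using tendsto_diff[OF e LIMSEQ_Suc[OF e]] by simp
  have small: "s \<longlonglongrightarrow> 0" if "\<And>k. 0 \<le> s k" "\<And>k. s k \<le> K * (E k - E (Suc k))" for s :: "nat \<Rightarrow> real" and K
  proof (rule real_tendsto_sandwich[of "\<lambda>_. 0"])
    show "(\<lambda>k. K * (E k - E (Suc k))) \<longlonglongrightarrow> 0" using tendsto_mult[OF tendsto_const drop, of K] by simp
  qed (use that in auto)
  have FG: "(\<lambda>k. F k + G k) \<longlonglongrightarrow> 0"
  proof (rule small[where K = "1 / 2"])
    show "0 \<le> F k + G k" for k using F[of k] G[of k] by simp
    show "F k + G k \<le> 1 / 2 * (E k - E (Suc k))" for k using E_Suc[of k] d[of k] by simp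
  qed
  \<comment> \<open>The type \<open>'z\<close> stays open because this serves both spaces.\<close>
  have small_d: "w \<longlonglongrightarrow> 0" if "\<And>k. \<delta> * (w k \<bullet> w k) \<le> d k" for w :: "nat \<Rightarrow> 'z::real_inner"
  proof (rule tendsto_zero_inner_self, rule small[where K = "2 / \<delta>"])
    show "w k \<bullet> w k \<le> 2 / \<delta> * (E k - E (Suc k))" for k
      using order_trans[OF that[of k], of "2 * (E k - E (Suc k))"] E_Suc[of k] F[of k] G[of k] \<delta>(1)
      by (simp add: field_simps)
  qed simp
  \<comment> \<open>The dual differences come first: once they vanish, so does
    \<open>A (c k) (c (Suc k))\<close>, and only then does the bound on
    \<open>a k - A (c k) (c (Suc k))\<close> control \<open>a\<close>.\<close>
  have c: "c \<longlonglongrightarrow> 0" by (rule small_d) (simp add: d_def \<delta>(2))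
  moreover have "(\<lambda>k. a k - A (c k) (c (Suc k))) \<longlonglongrightarrow> 0" by (rule small_d) (simp add: d_def \<delta>(3))
  ultimately have a: "a \<longlonglongrightarrow> 0"
    using tendsto_add[of _ 0 _ _ 0, OF _ A[OF c LIMSEQ_Suc[OF c]]] by fastforce
  show ?X ?Y using a c by (simp_all add: a_def c_def)
  have "(\<lambda>k. step_metric (a k) (c k)) \<longlonglongrightarrow> (0::'h) \<bullet> 0 / \<tau> + (0::'g) \<bullet> 0 / \<sigma> - (1 + \<theta>) * (L 0 \<bullet> 0)"
    unfolding step_metric_def divide_inverse by (intro tendsto_intros L.tendsto a c)
  then have "(\<lambda>k. E k - step_metric (a k) (c k) / 2 - (1 + \<theta>) * (F k + G k)) \<longlonglongrightarrow> e - 0 / 2 - (1 + \<theta>) * 0"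
    by (intro tendsto_intros e FG) simp_all
  then have "(\<lambda>k. step_metric (x (Suc k) - xs) (y (Suc k) - ys)) \<longlonglongrightarrow> e" by (simp add: E_def)
  then show ?C using LIMSEQ_imp_Suc[of "\<lambda>k. step_metric (x k - xs) (y k - ys)"] by (auto simp: convergent_def)
qed

text \<open>Minty's argument: testing the monotone inequalities with the resolvents \<open>u\<close>, \<open>v\<close> of the limit
  point avoids weak lower semicontinuity.\<close>

lemma cluster_point_saddle:
  assumes F: "F \<noteq> bot" "F \<le> sequentially"
    and bdd: "\<And>n. norm (x n) \<le> C" "\<And>n. norm (y n) \<le> C"
    and a: "(\<lambda>k. x (Suc k) - x k) \<longlonglongrightarrow> 0" and c: "(\<lambda>k. y (Suc k) - y k) \<longlonglongrightarrow> 0"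
    and lim: "\<And>w. ((\<lambda>n. x n \<bullet> w) \<longlongrightarrow> xb \<bullet> w) F" "\<And>w. ((\<lambda>n. y n \<bullet> w) \<longlongrightarrow> yb \<bullet> w) F"
  shows "- adjoint L yb \<in> subdifferential f xb \<and> L xb \<in> subdifferential h yb"
proof -
  have aF: "((\<lambda>k. x (Suc k) - x k) \<longlongrightarrow> 0) F" and cF: "((\<lambda>k. y (Suc k) - y k) \<longlongrightarrow> 0) F"
    using F(2) a c by (auto intro: tendsto_mono)
  have lim': "((\<lambda>n. x (Suc n) \<bullet> w) \<longlongrightarrow> xb \<bullet> w) F" "((\<lambda>n. y (Suc n) \<bullet> w') \<longlongrightarrow> yb \<bullet> w') F" for w w'
    using tendsto_add[OF lim(1)[of w] tendsto_inner[OF aF tendsto_const, of w]]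
      tendsto_add[OF lim(2)[of w'] tendsto_inner[OF cF tendsto_const, of w']]
    by (simp_all add: inner_diff_left)
  \<comment> \<open>These residuals measure by how much the iterate of index \<open>Suc n\<close>
    misses the saddle point conditions.\<close>
  define R S where "R = (\<lambda>n. adjoint L (y (Suc n) - y n) - (1 / \<tau>) *\<^sub>R (x (Suc n) - x n))"
    and "S = (\<lambda>n. \<theta> *\<^sub>R L (x (Suc n) - x n) - (1 / \<sigma>) *\<^sub>R (y (Suc n) - y n))"
  have "(R \<longlongrightarrow> adjoint L 0 - (1 / \<tau>) *\<^sub>R 0) F" "(S \<longlongrightarrow> \<theta> *\<^sub>R L 0 - (1 / \<sigma>) *\<^sub>R 0) F"
    unfolding R_def S_def
    by (intro tendsto_intros aF cF L.tendsto bounded_linear.tendsto[OF bounded_linear_adjoint[OF bounded_linear_L]])+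
  then have R: "(R \<longlongrightarrow> 0) F" and S: "(S \<longlongrightarrow> 0) F" by (simp_all add: L.zero)
  have pR: "p n = R n - adjoint L (y (Suc n))" and qS: "q n = S n + L (x (Suc n))" for n
    by (simp_all add: p_def q_def R_def S_def adj.diff L.add L.diff L.scaleR algebra_simps)
  define u v where "u = prox 1 f (xb - adjoint L yb)" and "v = prox 1 h (yb + L xb)"
  have u: "xb - adjoint L yb - u \<in> subdifferential f u" and v: "yb + L xb - v \<in> subdifferential h v"
    using prox_subgradient[OF f, of 1 "xb - adjoint L yb"] prox_subgradient[OF h, of 1 "yb + L xb"]
    by (simp_all add: u_def v_def)
  \<comment> \<open>Adding the two monotonicity inequalities cancels the products of
    \<open>L (x (Suc n))\<close> with \<open>y (Suc n)\<close>. Apart from the vanishing residual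
    terms, the rest is affine in the iterates, so weak limits suffice.\<close>
  have "0 \<le> R n \<bullet> (x (Suc n) - u) + S n \<bullet> (y (Suc n) - v) + y (Suc n) \<bullet> L u - x (Suc n) \<bullet> adjoint L v
      - (x (Suc n) \<bullet> (xb - adjoint L yb - u) - u \<bullet> (xb - adjoint L yb - u))
      - (y (Suc n) \<bullet> (yb + L xb - v) - v \<bullet> (yb + L xb - v))" (is "0 \<le> ?T n") for n
    using subdifferential_monotone[OF f(2) p_subgradient[of n] u]
      subdifferential_monotone[OF h(2) q_subgradient[of n] v]
    unfolding pR qS
    by (simp add: L.diff inner_diff_left inner_diff_right inner_add_left inner_add_right inner_adjoint inner_commute)
  moreover have "((\<lambda>n. ?T n) \<longlongrightarrow> 0 + 0 + yb \<bullet> L u - xb \<bullet> adjoint L v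
      - (xb \<bullet> (xb - adjoint L yb - u) - u \<bullet> (xb - adjoint L yb - u))
      - (yb \<bullet> (yb + L xb - v) - v \<bullet> (yb + L xb - v))) F"
  proof (intro tendsto_add tendsto_diff lim' tendsto_const)
    have "norm (x (Suc n) - u) \<le> C + norm u" for n
      using norm_triangle_ineq4[of "x (Suc n)" u] bdd(1)[of "Suc n"] by linarith
    then show "((\<lambda>n. R n \<bullet> (x (Suc n) - u)) \<longlongrightarrow> 0) F" by (rule tendsto_inner_bounded[OF R])
    have "norm (y (Suc n) - v) \<le> C + norm v" for n
      using norm_triangle_ineq4[of "y (Suc n)" v] bdd(2)[of "Suc n"] by linarith
    then show "((\<lambda>n. S n \<bullet> (y (Suc n) - v)) \<longlongrightarrow> 0) F" by (rule tendsto_inner_bounded[OF S])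
  qed
  ultimately have "0 \<le> 0 + 0 + yb \<bullet> L u - xb \<bullet> adjoint L v
      - (xb \<bullet> (xb - adjoint L yb - u) - u \<bullet> (xb - adjoint L yb - u))
      - (yb \<bullet> (yb + L xb - v) - v \<bullet> (yb + L xb - v))"
    by (intro tendsto_lowerbound[OF _ _ F(1)]) auto
  \<comment> \<open>By the choice of \<open>u\<close> and \<open>v\<close> the limit is minus a sum
    of squares, yet nonnegative.\<close>
  also have "\<dots> = - ((xb - u) \<bullet> (xb - u)) - (yb - v) \<bullet> (yb - v)"
    by (simp add: inner_diff_left inner_diff_right inner_add_left inner_add_right inner_adjoint inner_commute)
  finally have "(xb - u) \<bullet> (xb - u) = 0" "(yb - v) \<bullet> (yb - v) = 0"
    using inner_ge_zero[of "xb - u"] inner_ge_zero[of "yb - v"] by linarith+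
  then have "u = xb" "v = yb" by simp_all
  with u v show ?thesis by simp
qed

text \<open>Opial's lemma is applied in the product space. The given saddle point serves only to
  bound the iterates and to make the differences vanish; the limit may be another one.\<close>

lemma weak_convergence:
  assumes "- adjoint L y0 \<in> subdifferential f x0" "L x0 \<in> subdifferential h y0"
  shows "\<exists>xs ys. - adjoint L ys \<in> subdifferential f xs \<and> L xs \<in> subdifferential h ys
    \<and> weakly_converges (\<lambda>k. (x k, y k)) (xs, ys)"
proof -
  define z where "z = (\<lambda>k. (x k, y k))"
  \<comment> \<open>The self-adjoint block operator of \<open>step_metric\<close>; each off-diagonal
    block carries half of the coupling \<open>1 + \<theta>\<close>.\<close>
  define M where "M = (\<lambda>w. ((1 / \<tau>) *\<^sub>R fst w - ((1 + \<theta>) / 2) *\<^sub>R adjoint L (snd w),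
    (1 / \<sigma>) *\<^sub>R snd w - ((1 + \<theta>) / 2) *\<^sub>R L (fst w)))"
  define S where "S = {w. - adjoint L (snd w) \<in> subdifferential f (fst w) \<and> L (fst w) \<in> subdifferential h (snd w)}"
  obtain \<mu> where \<mu>: "\<mu> > 0" "\<And>u v. \<mu> * (u \<bullet> u + v \<bullet> v) \<le> step_metric u v"
    using step_metric_lower_bound by blast
  have M_eq: "M w \<bullet> w = step_metric (fst w) (snd w)" for w
    by (simp add: M_def step_metric_def inner_prod_def inner_diff_left inner_adjoint field_simps)
  have M_linear: "linear M"
    by (rule linearI) (auto simp: M_def adj.add adj.scale L.add L.scaleR algebra_simps)
  have M_sym: "M u \<bullet> w = u \<bullet> M w" for u w
    by (simp add: M_def inner_prod_def inner_diff_left inner_diff_right inner_adjoint inner_commute)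
  have M_pos: "M w \<bullet> w > 0" if "w \<noteq> 0" for w
  proof -
    have "0 < w \<bullet> w" using that by simp
    then have "0 < \<mu> * (fst w \<bullet> fst w + snd w \<bullet> snd w)" using \<mu>(1) by (simp add: inner_prod_def)
    also have "\<dots> \<le> M w \<bullet> w" by (simp add: M_eq \<mu>(2))
    finally show ?thesis .
  qed
  have conv: "convergent (\<lambda>n. M (z n - w) \<bullet> (z n - w))" if "w \<in> S" for w
    using that fejer_convergence(3)[of "snd w" "fst w"] by (simp add: S_def M_eq z_def)
  \<comment> \<open>The convergent metric distances are bounded, and coercivity with constant
    \<open>\<mu>\<close> turns this into a norm bound.\<close>
  have "Bseq (\<lambda>n. step_metric (x n - x0) (y n - y0))"
    using fejer_convergence(3)[OF assms] by (rule convergent_imp_Bseq)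
  then obtain K where K: "\<forall>n. \<bar>step_metric (x n - x0) (y n - y0)\<bar> \<le> K"
    unfolding Bseq_def real_norm_def by blast
  have z_bdd: "norm (z n) \<le> sqrt (K / \<mu>) + norm (x0, y0)" for n
  proof -
    have "\<mu> * ((z n - (x0, y0)) \<bullet> (z n - (x0, y0))) \<le> K"
      using \<mu>(2)[of "x n - x0" "y n - y0"] spec[OF K, of n] by (simp add: z_def inner_prod_def)
    then have "norm (z n - (x0, y0)) \<le> sqrt (K / \<mu>)"
      unfolding norm_eq_sqrt_inner using \<mu>(1) by (simp add: field_simps)
    then show ?thesis using norm_triangle_sub[of "z n" "(x0, y0)"] by linarith
  qed
  have "\<exists>w\<in>S. weakly_converges z w"
  proof (rule opial_weakly_converges[OF z_bdd M_linear M_sym M_pos conv])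
    fix F w
    assume F: "F \<noteq> bot" "F \<le> sequentially" "\<And>v. ((\<lambda>n. z n \<bullet> v) \<longlongrightarrow> w \<bullet> v) F"
    have "- adjoint L (snd w) \<in> subdifferential f (fst w) \<and> L (fst w) \<in> subdifferential h (snd w)"
    proof (rule cluster_point_saddle[OF F(1,2) _ _ fejer_convergence(1,2)[OF assms]])
      show "norm (x n) \<le> sqrt (K / \<mu>) + norm (x0, y0)" "norm (y n) \<le> sqrt (K / \<mu>) + norm (x0, y0)" for n
        using z_bdd[of n] norm_fst_le[of "x n" "y n"] norm_snd_le[of "y n" "x n"] by (simp_all add: z_def)
      show "((\<lambda>n. x n \<bullet> v) \<longlongrightarrow> fst w \<bullet> v) F" for v
        using F(3)[of "(v, 0)"] by (simp add: z_def inner_prod_def)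
      show "((\<lambda>n. y n \<bullet> v) \<longlongrightarrow> snd w \<bullet> v) F" for v
        using F(3)[of "(0, v)"] by (simp add: z_def inner_prod_def)
    qed
    then show "w \<in> S" by (simp add: S_def)
  qed
  then show ?thesis by (auto simp: S_def z_def)
qed

end

theorem theorem1p2:
  fixes f :: "'h::{real_inner,complete_space} \<Rightarrow> ereal"
    and g :: "'g::{real_inner,complete_space} \<Rightarrow> ereal"
    and L :: "'h \<Rightarrow> 'g"
    and \<tau> \<sigma> \<theta> :: real
    and x :: "nat \<Rightarrow> 'h" and y :: "nat \<Rightarrow> 'g"
  assumes "convex_fun f" and "proper_fun f" and "lsc_fun f"
    and "convex_fun g" and "proper_fun g" and "lsc_fun g"
    and "bounded_linear L"
    and "\<exists>p. kkt_point f g L p"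
    and "\<tau> > 0" and "\<sigma> > 0"
    and "0 < \<theta>" and "\<theta> \<le> 1 / 2"
    and "\<tau> * \<sigma> * (onorm L)\<^sup>2 < 4 * \<theta> * (2 - \<theta>) / (1 - 2 * \<theta> + 9 * \<theta>^2 - 4 * \<theta>^3)"
    and "\<And>k. x (Suc k) = prox \<tau> f (x k - \<tau> *\<^sub>R adjoint L (y k))"
    and "\<And>k. y (Suc k) = prox \<sigma> (convex_conjugate g)
                (y k + \<sigma> *\<^sub>R L (x (Suc k) + \<theta> *\<^sub>R (x (Suc k) - x k)))"
  shows "\<exists>p. kkt_point f g L p \<and> weakly_converges (\<lambda>k. (x k, y k)) p"
proof -
  \<comment> \<open>Both the iteration and the KKT condition see \<open>g\<close> through its
    conjugate, which takes the role of \<open>h\<close>.\<close>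
  have conj: "convex_fun (convex_conjugate g)" "proper_fun (convex_conjugate g)" "lsc_fun (convex_conjugate g)"
    using assms(4-6) convex_conjugate_convex_fun convex_conjugate_proper_fun convex_conjugate_lsc_fun by auto
  interpret chambolle_pock_iteration L \<tau> \<sigma> \<theta> f "convex_conjugate g" x y
  proof (intro chambolle_pock_iteration.intro chambolle_pock_parameters.intro chambolle_pock_iteration_axioms.intro)
    show "\<theta> < 1" using assms(12) by simp
  qed (fact assms conj)+
  obtain x0 y0 where "- adjoint L y0 \<in> subdifferential f x0" "L x0 \<in> subdifferential (convex_conjugate g) y0"
    using assms(8) by (auto simp: kkt_point_def)
  from weak_convergence[OF this] show ?thesis by (auto simp: kkt_point_def)
qed

end
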